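(* Let $l<k$ be positive integers, let $A,B_1,\dots,B_k$ be finite sets in a commutative group with $A$ nonempty, $K=\{1,\dots,k\}$, $B_I=\sum_{i\in I}B_i$, $|A|=m$, $|A+B_I|=\alpha_Im$, and $\beta=\bigl(\prod_{L\subseteq K,|L|=l}\alpha_L\bigr)^{(l-1)!(k-l)!/(k-1)!}$. (a) For every integer $a$ with $1\le a\le m$ there exists $X\subseteq A$ with $|X|\ge a$ such that $$|X+B_K|\le \beta m^{k/l}\Bigl(m^{-k/l}+(m-1)^{-k/l}+\dots+(m-a+1)^{-k/l}+(|X|-a)(m-a+1)^{-k/l}\Bigr).$$ (b) For every real $t$ with $0\le t<m$ there exists $X\subseteq A$ with $|X|>t$ such that $$|X+B_K|\le \beta m^{k/l}\Bigl(\frac{l}{k-l}\bigl((m-t)^{1-k/l}-m^{1-k/l}\bigr)+(|X|-t)(m-t)^{-k/l}\Bigr).$$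
   Context: Sumsets are $X+Y=\{x+y:x\in X,y\in Y\}$. *)

theory Defs
  imports Complex_Main
begin

definition sumset :: "'a::ab_group_add set \<Rightarrow> 'a set \<Rightarrow> 'a set" where
  "sumset X Y = {x + y | x y. x \<in> X \<and> y \<in> Y}"

text \<open>Iterated sumset B_I = sum over i in I of B_i (for finite I; B_{} = {0}).\<close>
definition sumset_fam :: "(nat \<Rightarrow> 'a::ab_group_add set) \<Rightarrow> nat set \<Rightarrow> 'a set" where
  "sumset_fam B I = {sum f I | f. \<forall>i\<in>I. f i \<in> B i}"

end

theory Submission
  imports Defs "HOL-Library.Function_Algebras"
begin

text \<open>A level of the graph weighs a sum over its sets L, whereas the bound sought is a product
  over them. The two match when all terms of the sum are equal, and k free weights can arrange this
  for k terms: hence k = l + 1, where the sets L are the complements of single indices. For smaller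
  l there are more sets than weights, so one index is added at a time.

  That induction needs more than existence. For a set I of size j + 1 the step uses bounds for all
  j-subsets of I on one and the same X, so several bounds must hold simultaneously. They are imposed
  one after another, each time passing to a subset, and a subset of positive proportion spoils
  earlier bounds only by a constant factor. These constants depend on the index sets but not on A or
  the B_i. Hence one constant serves for all direct powers, where the growth factors become r-th
  powers and the constant stays as it is.

  The exponent k/l comes from counting: \<open>mean_growth\<close> is a product of (k choose l)
  factors with exponent 1 / ((k-1) choose (l-1)), so scaling every factor by q scales it by q to the
  power k/l.\<close>

text \<open>
  The core is a Pluennecke inequality for different summands: some nonempty \<open>X \<subseteq> A\<close> satisfies
  \<open>|X + B\<^sub>K| \<le> \<beta> |X|\<close>. Following Petridis, consider the commutative graph with layers \<open>A + B\<^sub>I\<close> and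
  multiplicative weights on it. A vertex cutset of minimal weight can be pushed into the two
  extreme layers, so it weighs \<open>|A|\<close> when the magnification ratio is large enough, and comparing it
  with the cutset formed by a middle layer settles \<open>k = l + 1\<close> up to a constant. Losing further
  constants, \<open>X\<close> may be taken to contain a positive proportion of \<open>A\<close> and to work for all
  \<open>(l + 1)\<close>-subsets at once, which allows induction from \<open>l\<close> up to \<open>k\<close>; the tensor power trick removes
  the constants.

  Large \<open>X\<close> are then obtained greedily: after removing \<open>r\<close> elements from \<open>A\<close> the growth factors increase by
  at most \<open>m / (m - r)\<close>, hence \<open>\<beta>\<close> by at most \<open>(m / (m - r))\<^bsup>k / l\<^esup>\<close>.
\<close>

section \<open>Sumsets\<close>

abbreviation (input) shifted :: "'a::ab_group_add set \<Rightarrow> (nat \<Rightarrow> 'a set) \<Rightarrow> nat set \<Rightarrow> 'a set" where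
  "shifted A B I \<equiv> sumset A (sumset_fam B I)"

lemma sumsetI: "x \<in> X \<Longrightarrow> y \<in> Y \<Longrightarrow> x + y \<in> sumset X Y"
  unfolding sumset_def by blast

lemma sumsetE:
  assumes "v \<in> sumset X Y"
  obtains x y where "x \<in> X" "y \<in> Y" "v = x + y"
  using assms unfolding sumset_def by blast

lemma sumset_zero: "sumset {0} S = S"
  by (auto simp: sumset_def)

lemma sumset_assoc: "sumset (sumset X Y) Z = sumset X (sumset Y Z)"
proof (intro equalityI subsetI)
  fix v assume "v \<in> sumset (sumset X Y) Z"
  then obtain x y z where "x \<in> X" "y \<in> Y" "z \<in> Z" "v = x + y + z" by (auto elim!: sumsetE)
  then show "v \<in> sumset X (sumset Y Z)" by (simp add: add.assoc sumsetI)
next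
  fix v assume "v \<in> sumset X (sumset Y Z)"
  then obtain x y z where "x \<in> X" "y \<in> Y" "z \<in> Z" "v = x + (y + z)" by (auto elim!: sumsetE)
  then show "v \<in> sumset (sumset X Y) Z" by (simp add: sumsetI flip: add.assoc)
qed

lemma mem_shifted:
  "v \<in> shifted A B I \<longleftrightarrow> (\<exists>a\<in>A. \<exists>f. (\<forall>i\<in>I. f i \<in> B i) \<and> v = a + sum f I)"
  unfolding sumset_def sumset_fam_def by blast

lemma finite_sumset: "finite X \<Longrightarrow> finite Y \<Longrightarrow> finite (sumset X Y)"
  unfolding sumset_def by (rule finite_image_set2) auto

lemma sumset_mono: "X \<subseteq> X' \<Longrightarrow> sumset X Y \<subseteq> sumset X' Y"
  by (auto simp: sumset_def)

lemma sumset_Un: "sumset (X \<union> X') Y = sumset X Y \<union> sumset X' Y"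
  by (auto simp: sumset_def)

lemma shifted_empty [simp]: "shifted A B {} = A"
  by (auto simp: mem_shifted)

lemma shifted_insert:
  assumes "finite I" "i \<notin> I"
  shows "shifted A B (insert i I) = sumset (shifted A B I) (B i)"
proof (intro set_eqI iffI)
  fix v assume "v \<in> shifted A B (insert i I)"
  then obtain a f where "a \<in> A" "\<forall>j\<in>insert i I. f j \<in> B j" "v = a + sum f (insert i I)"
    unfolding mem_shifted by blast
  moreover from this have "v = (a + sum f I) + f i" using assms by (simp add: ac_simps)
  ultimately show "v \<in> sumset (shifted A B I) (B i)"
    unfolding sumset_def[of "shifted A B I"] mem_Collect_eq mem_shifted by blast
next
  fix v assume "v \<in> sumset (shifted A B I) (B i)"
  then obtain a f b where *: "a \<in> A" "\<forall>j\<in>I. f j \<in> B j" "b \<in> B i" "v = a + sum f I + b"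
    unfolding sumset_def[of "shifted A B I"] mem_Collect_eq mem_shifted by blast
  have "sum (f(i := b)) (insert i I) = b + sum f I"
    using assms by (auto intro!: sum.cong)
  then have "v = a + sum (f(i := b)) (insert i I)" using * by (simp add: ac_simps)
  moreover have "\<forall>j\<in>insert i I. (f(i := b)) j \<in> B j" using * assms by auto
  ultimately show "v \<in> shifted A B (insert i I)" using * unfolding mem_shifted by blast
qed

lemma finite_shifted:
  assumes "finite I" "finite A" "\<And>i. i \<in> I \<Longrightarrow> finite (B i)"
  shows "finite (shifted A B I)"
  using assms by (induction I) (auto simp: shifted_insert finite_sumset)

lemma shifted_nonempty:
  assumes "A \<noteq> {}" "\<And>i. i \<in> I \<Longrightarrow> B i \<noteq> {}"
  shows "shifted A B I \<noteq> {}"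
proof -
  obtain a where "a \<in> A" using assms by auto
  moreover obtain f where "\<forall>i\<in>I. f i \<in> B i" using assms(2) bchoice[of I "\<lambda>i b. b \<in> B i"] by blast
  ultimately have "a + sum f I \<in> shifted A B I" unfolding mem_shifted by blast
  then show ?thesis by auto
qed

lemma shifted_eq_empty: "i \<in> I \<Longrightarrow> B i = {} \<Longrightarrow> shifted A B I = {}"
  using mem_shifted[of _ A B I] by blast

section \<open>Cutsets in weighted commutative graphs\<close>

text \<open>Layer cake summation: under the Hall type last hypothesis every superlevel set of g is
  outweighed by its neighbourhood, and f is at least as large there. The induction peels off one
  layer, subtracting the least value c of g from both functions, after which only the points with g
  > c remain.\<close>

lemma weighted_layer_cake:
  fixes wt f :: "'u \<Rightarrow> real" and g wt' :: "'s \<Rightarrow> real"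
  assumes "finite S" "finite U" and wt: "\<And>u. u \<in> U \<Longrightarrow> 0 \<le> wt u"
    and "\<And>s. s \<in> S \<Longrightarrow> 0 \<le> g s"
    and "\<And>u s. u \<in> U \<Longrightarrow> s \<in> S \<Longrightarrow> R u s \<Longrightarrow> g s \<le> f u"
    and "\<And>T. T \<subseteq> S \<Longrightarrow> sum wt' T \<le> sum wt {u \<in> U. \<exists>s\<in>T. R u s}"
  shows "(\<Sum>s\<in>S. wt' s * g s) \<le> (\<Sum>u\<in>{u \<in> U. \<exists>s\<in>S. R u s}. wt u * f u)"
  using assms(1,4-)
proof (induction "card S" arbitrary: S f g rule: less_induct)
  case less
  show ?case
  proof (cases "S = {}")
    case False
    define c where "c = Min (g ` S)"
    define N where "N = (\<lambda>T. {u \<in> U. \<exists>s\<in>T. R u s})"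
    define S' where "S' = {s \<in> S. g s > c}"
    have c_le: "c \<le> g s" if "s \<in> S" for s using that less.prems(1) by (simp add: c_def)
    have "c \<in> g ` S" using False less.prems(1) by (simp add: c_def)
    then obtain s0 where s0: "s0 \<in> S" "g s0 = c" by auto
    then have "0 \<le> c" using less.prems(2) by auto
    have "S' \<subset> S" using s0 by (auto simp: S'_def)
    then have "card S' < card S" using less.prems(1) by (rule psubset_card_mono[rotated])
    have finN: "finite (N S)" using assms(2) by (simp add: N_def)
    have "(\<Sum>s\<in>S. wt' s * (g s - c)) = (\<Sum>s\<in>S'. wt' s * (g s - c))"
      using less.prems(1) c_le by (intro sum.mono_neutral_right) (force simp: S'_def)+
    also have "\<dots> \<le> (\<Sum>u\<in>N S'. wt u * (f u - c))"
      unfolding N_def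
    proof (rule less.hyps)
      show "card S' < card S" by fact
      show "finite S'" using less.prems(1) by (simp add: S'_def)
    next
      fix T assume "T \<subseteq> S'"
      then have "T \<subseteq> S" by (auto simp: S'_def)
      then show "sum wt' T \<le> sum wt {u \<in> U. \<exists>s\<in>T. R u s}" by (rule less.prems(4))
    qed (use less.prems(3) in \<open>auto simp: S'_def\<close>)
    \<comment> \<open>The additional neighbours still see a point of S, where g is at least c, so
      their terms are nonnegative.\<close>
    also have "\<dots> \<le> (\<Sum>u\<in>N S. wt u * (f u - c))"
    proof (rule sum_mono2[OF finN])
      show "N S' \<subseteq> N S" by (auto simp: N_def S'_def)
      fix u assume "u \<in> N S - N S'"
      then obtain s where "u \<in> U" "s \<in> S" "R u s" by (auto simp: N_def)
      then have "c \<le> f u" using less.prems(3) c_le by force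
      then show "0 \<le> wt u * (f u - c)" using wt \<open>u \<in> U\<close> by simp
    qed
    finally have 1: "(\<Sum>s\<in>S. wt' s * (g s - c)) \<le> (\<Sum>u\<in>N S. wt u * (f u - c))" .
    have "c * sum wt' S \<le> c * sum wt (N S)"
      using less.prems(4)[of S] \<open>0 \<le> c\<close> by (auto simp: N_def intro: mult_left_mono)
    with 1 have "(\<Sum>s\<in>S. wt' s * g s) \<le> (\<Sum>u\<in>N S. wt u * f u)"
      by (simp add: algebra_simps sum_subtractf sum_distrib_left)
    then show ?thesis by (simp add: N_def)
  qed simp
qed

text \<open>The double counting at the heart of the argument: by commutativity the degrees grow
  outwards from the middle layer, by minimality so do the weights, and counting edges on
  both sides forces equality.\<close>

lemma middle_layer_weight:
  fixes wt :: "'v \<Rightarrow> real" and E :: "'v \<Rightarrow> 'v \<Rightarrow> bool"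
  assumes fin: "finite U" "finite S" "finite W"
    and pos: "\<And>v. 0 < wt v"
    and below: "\<And>T. T \<subseteq> S \<Longrightarrow> sum wt T \<le> sum wt {u \<in> U. \<exists>s\<in>T. E u s}"
    and above: "\<And>T. T \<subseteq> S \<Longrightarrow> sum wt T \<le> sum wt {w \<in> W. \<exists>s\<in>T. E s w}"
    and out: "\<And>u s. u \<in> U \<Longrightarrow> s \<in> S \<Longrightarrow> E u s \<Longrightarrow> card {w \<in> W. E s w} \<le> card {v \<in> S. E u v}"
    and into: "\<And>s w. s \<in> S \<Longrightarrow> w \<in> W \<Longrightarrow> E s w \<Longrightarrow>
      (\<Sum>u | u \<in> U \<and> E u s. wt u / wt s) \<le> (\<Sum>v | v \<in> S \<and> E v w. wt v / wt w)"
    and U: "\<And>u. u \<in> U \<Longrightarrow> \<exists>s\<in>S. E u s" and W: "\<And>w. w \<in> W \<Longrightarrow> \<exists>s\<in>S. E s w"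
  shows "sum wt U \<le> sum wt S"
proof -
  define dout where "dout = (\<lambda>s. real (card {w \<in> W. E s w}))"
  define dU where "dU = (\<lambda>u. real (card {v \<in> S. E u v}))"
  \<comment> \<open>The weighted in-degrees make every edge count with the weight of its tail,
    whether it is counted from above or from below.\<close>
  define din where "din = (\<lambda>s. \<Sum>u | u \<in> U \<and> E u s. wt u / wt s)"
  define dW where "dW = (\<lambda>w. \<Sum>v | v \<in> S \<and> E v w. wt v / wt w)"
  have NU: "{u \<in> U. \<exists>s\<in>S. E u s} = U" using U by auto
  have NW: "{w \<in> W. \<exists>s\<in>S. E s w} = W" using W by auto
  \<comment> \<open>By \<open>above\<close> for a singleton, a positive weight needs at least one
    neighbour above; so \<open>dout s - 1\<close> is a legitimate nonnegative function for the layer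
    cake lemma.\<close>
  have dout1: "1 \<le> dout s" if "s \<in> S" for s
  proof -
    have "0 < sum wt {s}" using pos by simp
    also have "\<dots> \<le> sum wt {w \<in> W. \<exists>s\<in>{s}. E s w}" using that by (intro above) auto
    finally have "{w \<in> W. E s w} \<noteq> {}" by (auto simp del: Collect_empty_eq)
    then have "card {w \<in> W. E s w} > 0" using fin by (simp add: card_gt_0_iff)
    then show ?thesis unfolding dout_def by linarith
  qed
  \<comment> \<open>The shift by 1 produces the conclusion: the four degree sums form a closed chain
    of inequalities and cancel, and what is left are the total weights of U and S.\<close>
  have "(\<Sum>s\<in>S. wt s * (dout s - 1)) \<le> (\<Sum>u\<in>{u \<in> U. \<exists>s\<in>S. E u s}. wt u * (dU u - 1))"
    by (rule weighted_layer_cake)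
       (use fin pos less_imp_le below out dout1 in \<open>auto simp: dout_def dU_def\<close>)
  then have 1: "(\<Sum>s\<in>S. wt s * dout s) - sum wt S \<le> (\<Sum>u\<in>U. wt u * dU u) - sum wt U"
    by (simp add: NU algebra_simps sum_subtractf)
  have "(\<Sum>s\<in>S. wt s * din s) \<le> (\<Sum>w\<in>{w \<in> W. \<exists>s\<in>S. E s w}. wt w * dW w)"
  proof (rule weighted_layer_cake)
    show "0 \<le> din s" for s unfolding din_def by (intro sum_nonneg) (simp add: pos less_imp_le)
  qed (use fin pos less_imp_le above into in \<open>auto simp: din_def dW_def\<close>)
  then have 2: "(\<Sum>s\<in>S. wt s * din s) \<le> (\<Sum>w\<in>W. wt w * dW w)" by (simp add: NW)
  have ne: "wt v \<noteq> 0" for v using pos[of v] by simp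
  have swap: "(\<Sum>x\<in>X. \<Sum>y | y \<in> Y \<and> P x y. h x y) = (\<Sum>y\<in>Y. \<Sum>x | x \<in> X \<and> P x y. h x y)"
    if "finite X" "finite Y" for X Y and h :: "'v \<Rightarrow> 'v \<Rightarrow> real" and P
    using sum.swap_restrict[OF that, of h P] by simp
  have "(\<Sum>u\<in>U. wt u * dU u) = (\<Sum>u\<in>U. \<Sum>s | s \<in> S \<and> E u s. wt u)"
    by (simp add: dU_def mult.commute)
  also have "\<dots> = (\<Sum>s\<in>S. wt s * din s)"
    by (subst swap) (simp_all add: fin din_def sum_distrib_left ne)
  finally have 3: "(\<Sum>u\<in>U. wt u * dU u) = (\<Sum>s\<in>S. wt s * din s)" .
  have "(\<Sum>w\<in>W. wt w * dW w) = (\<Sum>w\<in>W. \<Sum>s | s \<in> S \<and> E s w. wt s)"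
    by (simp add: dW_def sum_distrib_left ne)
  also have "\<dots> = (\<Sum>s\<in>S. \<Sum>w | w \<in> W \<and> E s w. wt s)"
    by (rule swap[where P = "\<lambda>w s. E s w"]) (use fin in auto)
  also have "\<dots> = (\<Sum>s\<in>S. wt s * dout s)" by (simp add: dout_def mult.commute)
  finally show ?thesis using 1 2 3 by simp
qed

section \<open>Reachability and cutsets in a directed graph\<close>

text \<open>Endpoints have to avoid S as well, so that a cutset may contain vertices of the two
  terminal sets; in particular V itself is a cutset.\<close>

inductive reach :: "('v \<Rightarrow> 'v \<Rightarrow> bool) \<Rightarrow> 'v set \<Rightarrow> 'v set \<Rightarrow> 'v \<Rightarrow> bool"
  for E V S where
  source: "v \<in> V \<Longrightarrow> v \<notin> S \<Longrightarrow> reach E V S v"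
| step: "reach E V S u \<Longrightarrow> E u v \<Longrightarrow> v \<notin> S \<Longrightarrow> reach E V S v"

lemma reach_avoids: "reach E V S v \<Longrightarrow> v \<notin> S"
  by (erule reach.cases) auto

definition cutset :: "('v \<Rightarrow> 'v \<Rightarrow> bool) \<Rightarrow> 'v set \<Rightarrow> 'v set \<Rightarrow> 'v set \<Rightarrow> bool" where
  "cutset E V V' S \<longleftrightarrow> (\<forall>v\<in>V'. \<not> reach E V S v)"

text \<open>A path from V to v and a backward path from V' to v, both avoiding S, would combine to a
  path from V to V'. The induction moves v along the backward path.\<close>

lemma cutset_not_both:
  assumes "cutset E V V' S" "reach E\<inverse>\<inverse> V' S v"
  shows "\<not> reach E V S v"
  using assms(2)
proof induction
  case (source v)
  then show ?case using assms(1) by (auto simp: cutset_def)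
next
  case (step u v)
  then show ?case using reach_avoids[OF step.hyps(1)] by (auto intro: reach.step)
qed

lemma cutset_converse: "cutset E V V' S \<Longrightarrow> cutset E\<inverse>\<inverse> V' V S"
  unfolding cutset_def[of "E\<inverse>\<inverse>"] by (meson cutset_not_both reach.source reach_avoids)

text \<open>A path that avoids the new set cannot enter T: the vertex just before its first entry is
  reachable outside S and has an edge into T, so it belongs to the new set. It cannot start in T
  either, hence it avoids S.\<close>

lemma cutset_push:
  assumes "cutset E V V' S" "T \<inter> V = {}"
  shows "cutset E V V' (S - T \<union> {u. reach E V S u \<and> (\<exists>t\<in>T. E u t)})" (is "cutset E V V' ?S'")
proof -
  have "reach E V S v" if "reach E V ?S' v" for v
    using that
  proof induction
    case (source v)
    then show ?case using assms(2) by (auto intro: reach.source)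
  next
    case (step u v)
    then have "v \<notin> T" using reach_avoids[OF step.hyps(1)] by blast
    then show ?case using step by (auto intro: reach.step)
  qed
  then show ?thesis using assms(1) by (auto simp: cutset_def)
qed

text \<open>A vertex \<open>(I, v)\<close> with \<open>v \<in> A + B\<^sub>I\<close> remembers which summands have been used, so that no
  summand is used twice along a path; its weight is the product of the \<open>x\<^sub>i\<close> with \<open>i \<in> I\<close>.\<close>

locale sumset_graph =
  fixes A :: "'a::ab_group_add set" and B :: "nat \<Rightarrow> 'a set" and K :: "nat set"
    and x :: "nat \<Rightarrow> real"
  assumes finite_K: "finite K" and finite_A: "finite A"
    and finite_B: "\<And>i. i \<in> K \<Longrightarrow> finite (B i)"
    and x_pos: "\<And>i. 0 < x i"
begin

definition edge :: "nat set \<times> 'a \<Rightarrow> nat set \<times> 'a \<Rightarrow> bool" where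
  "edge p q \<longleftrightarrow> (\<exists>i\<in>K - fst p. fst q = insert i (fst p) \<and> snd q - snd p \<in> B i)"

lemma edgeE:
  assumes "edge p q"
  obtains i where "i \<in> K" "i \<notin> fst p" "fst q = insert i (fst p)" "snd q - snd p \<in> B i"
  using assms unfolding edge_def by blast

lemma edgeI:
  "i \<in> K \<Longrightarrow> i \<notin> fst p \<Longrightarrow> fst q = insert i (fst p) \<Longrightarrow> snd q - snd p \<in> B i \<Longrightarrow> edge p q"
  unfolding edge_def by blast

definition V :: "(nat set \<times> 'a) set" where
  "V = (SIGMA I:Pow K. shifted A B I)"

definition V0 :: "(nat set \<times> 'a) set" where
  "V0 = {{}} \<times> A"

definition V1 :: "(nat set \<times> 'a) set" where
  "V1 = {K} \<times> shifted A B K"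

definition wt :: "nat set \<times> 'a \<Rightarrow> real" where
  "wt p = (\<Prod>i\<in>fst p. x i)"

definition min_cut :: "(nat set \<times> 'a) set \<Rightarrow> bool" where
  "min_cut S \<longleftrightarrow> S \<subseteq> V \<and> cutset edge V0 V1 S \<and>
     (\<forall>S'. S' \<subseteq> V \<longrightarrow> cutset edge V0 V1 S' \<longrightarrow> sum wt S \<le> sum wt S')"

lemma finite_V: "finite V"
  unfolding V_def using finite_K finite_A finite_B
  by (intro finite_SigmaI finite_shifted) (auto intro: finite_subset[of _ K])

lemma V0_subset: "V0 \<subseteq> V"
  by (auto simp: V_def V0_def)

lemma fst_V: "p \<in> V \<Longrightarrow> fst p \<subseteq> K"
  by (auto simp: V_def)

lemma finite_fst_V: "p \<in> V \<Longrightarrow> finite (fst p)"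
  using fst_V finite_K finite_subset by blast

lemma wt_pos: "0 < wt p"
  unfolding wt_def by (simp add: x_pos prod_pos)

lemma edge_V: "p \<in> V \<Longrightarrow> edge p q \<Longrightarrow> q \<in> V"
proof -
  assume p: "p \<in> V" and "edge p q"
  then obtain i where i: "i \<in> K - fst p" "fst q = insert i (fst p)" "snd q - snd p \<in> B i"
    by (auto simp: edge_def)
  have "snd p \<in> shifted A B (fst p)" using p by (auto simp: V_def)
  then have "snd p + (snd q - snd p) \<in> sumset (shifted A B (fst p)) (B i)"
    using i(3) unfolding sumset_def[of "shifted A B (fst p)"] by blast
  then have "snd q \<in> shifted A B (fst q)"
    using i shifted_insert[of "fst p" i A B] finite_fst_V[OF p] by simp
  then show ?thesis using i fst_V[OF p] by (cases q) (auto simp: V_def)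
qed

lemma edge_card: "p \<in> V \<Longrightarrow> edge p q \<Longrightarrow> card (fst q) = Suc (card (fst p))"
  using finite_fst_V[of p] by (auto simp: edge_def)

lemma reach_V: "reach edge V0 S p \<Longrightarrow> p \<in> V"
  by (induction rule: reach.induct) (use V0_subset edge_V in blast)+

section \<open>Commutativity: completing squares\<close>

text \<open>If u -> s -> w adds an element of \<open>B i\<close> and then one of \<open>B j\<close>,
  this is the vertex reached from u by adding the second element first.\<close>

definition complete_square ::
  "nat set \<times> 'a \<Rightarrow> nat set \<times> 'a \<Rightarrow> nat set \<times> 'a \<Rightarrow> nat set \<times> 'a" where
  "complete_square u s w = (fst u \<union> (fst w - fst s), snd u + (snd w - snd s))"

lemma complete_square_edges:
  assumes "edge u s" "edge s w"
  shows "edge u (complete_square u s w)" "edge (complete_square u s w) w"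
proof -
  obtain i where i: "i \<in> K" "i \<notin> fst u" "fst s = insert i (fst u)" "snd s - snd u \<in> B i"
    using assms(1) by (rule edgeE)
  obtain j where j: "j \<in> K" "j \<notin> fst s" "fst w = insert j (fst s)" "snd w - snd s \<in> B j"
    using assms(2) by (rule edgeE)
  let ?v = "complete_square u s w"
  have "fst w - fst s = {j}" using j by blast
  then have v: "fst ?v = insert j (fst u)" by (simp add: complete_square_def)
  have sv: "snd ?v - snd u = snd w - snd s" "snd w - snd ?v = snd s - snd u"
    by (simp_all add: complete_square_def)
  have "j \<notin> fst u" "i \<noteq> j" using i j by blast+
  then show "edge u ?v" by (intro edgeI[of j]) (use j v sv in simp_all)
  have "fst w = insert i (fst ?v)" "i \<notin> fst ?v" using i j v \<open>i \<noteq> j\<close> by blast+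
  then show "edge ?v w" by (intro edgeI[of i]) (use i sv in simp_all)
qed

text \<open>Weights are multiplicative, so both quotients are \<open>1 / x i\<close> for the index i
  added on opposite sides of the square.\<close>

lemma complete_square_wt:
  assumes "u \<in> V" "edge u s" "edge s w"
  shows "wt (complete_square u s w) / wt w = wt u / wt s"
proof -
  obtain i where i: "i \<notin> fst u" "fst s = insert i (fst u)"
    using assms(2) by (rule edgeE)
  obtain j where j: "j \<notin> fst s" "fst w = insert j (fst s)"
    using assms(3) by (rule edgeE)
  have "fst w - fst s = {j}" using j by blast
  then have v: "fst (complete_square u s w) = insert j (fst u)" by (simp add: complete_square_def)
  have "wt s = x i * wt u" "wt w = x j * wt s" "wt (complete_square u s w) = x j * wt u"
    using i j finite_fst_V[OF assms(1)] unfolding wt_def v by simp_all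
  then show ?thesis using x_pos[of i] x_pos[of j] by simp
qed

text \<open>Embeds the out-neighbours of s into those of u: Pluennecke's condition for out-degrees,
  which supplies \<open>out\<close> in \<open>middle_layer_weight\<close>.\<close>

lemma complete_square_inj_up:
  assumes "edge u s"
  shows "inj_on (complete_square u s) {w. edge s w}"
proof (rule inj_onI)
  fix w w' assume w: "w \<in> {w. edge s w}" "w' \<in> {w. edge s w}"
    and eq: "complete_square u s w = complete_square u s w'"
  have "fst u \<subseteq> fst s" using assms by (auto elim: edgeE)
  moreover have "fst s \<subseteq> fst w" "fst s \<subseteq> fst w'" using w by (auto elim: edgeE)
  moreover have "fst u \<union> (fst w - fst s) = fst u \<union> (fst w' - fst s)" "snd w = snd w'"
    using eq by (auto simp: complete_square_def)
  ultimately show "w = w'" by (intro prod_eqI) blast+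
qed

text \<open>The dual condition for in-neighbours; together with \<open>complete_square_wt\<close> it
  supplies \<open>into\<close> in \<open>middle_layer_weight\<close>.\<close>

lemma complete_square_inj_down:
  assumes "edge s w"
  shows "inj_on (\<lambda>u. complete_square u s w) {u. edge u s}"
proof (rule inj_onI)
  fix u u' assume u: "u \<in> {u. edge u s}" "u' \<in> {u. edge u s}"
    and eq: "complete_square u s w = complete_square u' s w"
  have "fst u \<subseteq> fst s" "fst u' \<subseteq> fst s" using u by (auto elim: edgeE)
  moreover have "fst u \<union> (fst w - fst s) = fst u' \<union> (fst w - fst s)" "snd u = snd u'"
    using eq by (auto simp: complete_square_def)
  ultimately show "u = u'" by (intro prod_eqI) blast+
qed

section \<open>Pushing minimal cutsets to the extreme layers\<close>

lemma min_cut_exists: "\<exists>S. min_cut S"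
proof -
  let ?C = "{S. S \<subseteq> V \<and> cutset edge V0 V1 S}"
  have "finite ?C" using finite_V by simp
  moreover have "V0 \<in> ?C"
  proof -
    have "\<not> reach edge V0 V0 p" for p
    proof
      assume "reach edge V0 V0 p" then show False by induction auto
    qed
    then show ?thesis using V0_subset by (auto simp: cutset_def)
  qed
  ultimately obtain S where "is_arg_min (sum wt) (\<lambda>S. S \<in> ?C) S"
    using ex_is_arg_min_if_finite[of ?C "sum wt"] by blast
  then show ?thesis unfolding is_arg_min_linorder min_cut_def by blast
qed

text \<open>Exchanging T for S' cannot make a minimal cutset lighter. This is the source of the Hall
  type conditions \<open>below\<close> and \<open>above\<close> of
  \<open>middle_layer_weight\<close>.\<close>

lemma min_cut_push_weight:
  assumes "min_cut S" "T \<subseteq> S" "S' \<subseteq> V" "cutset edge V0 V1 (S - T \<union> S')"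
  shows "sum wt T \<le> sum wt S'"
proof -
  have S: "finite S" "S \<subseteq> V" using assms(1) finite_subset[OF _ finite_V] by (auto simp: min_cut_def)
  have "sum wt S \<le> sum wt (S - T \<union> S')"
  proof -
    have "S - T \<union> S' \<subseteq> V" using S assms(3) by auto
    then show ?thesis using assms(1,4) unfolding min_cut_def by blast
  qed
  also have "\<dots> \<le> sum wt (S - T) + sum wt S'"
    using S finite_subset[OF assms(3) finite_V] wt_pos[THEN less_imp_le]
    by (subst sum_Un) (auto intro: sum_nonneg)
  also have "sum wt (S - T) = sum wt S - sum wt T"
    using S assms(2) by (simp add: sum_diff)
  finally show ?thesis by simp
qed

text \<open>By \<open>middle_layer_weight\<close> the reachable neighbours U below level j weigh no
  more than T, and by \<open>cutset_push\<close> they may replace T. The middle position of level j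
  matters because pushes in both directions are used: T must miss both \<open>V0\<close> and
  \<open>V1\<close>.\<close>

lemma min_cut_push_level:
  assumes S: "min_cut S" and j: "0 < j" "j < card K"
  defines "T \<equiv> {s \<in> S. card (fst s) = j}"
  defines "U \<equiv> {u. reach edge V0 S u \<and> (\<exists>s\<in>T. edge u s)}"
  shows "min_cut (S - T \<union> U)"
proof -
  define W where "W = {w. reach edge\<inverse>\<inverse> V1 S w \<and> (\<exists>s\<in>T. edge s w)}"
  have SV: "S \<subseteq> V" and cut: "cutset edge V0 V1 S" using S by (auto simp: min_cut_def)
  have TS: "T \<subseteq> S" by (auto simp: T_def)
  have TV: "T \<subseteq> V" using SV TS by simp
  have UV: "U \<subseteq> V" by (auto simp: U_def reach_V)
  have WV: "W \<subseteq> V" using TV edge_V by (auto simp: W_def)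
  have T0: "T \<inter> V0 = {}" using j by (auto simp: T_def V0_def)
  have T1: "T \<inter> V1 = {}" using j by (auto simp: T_def V1_def)
  \<comment> \<open>The fourth vertex lies on a path through u and w from \<open>V0\<close> to
    \<open>V1\<close> whose other vertices, outside T, avoid S. As S is a cutset, this vertex is in
    S, and its level is that of s.\<close>
  have square_in_T: "complete_square u s w \<in> T"
    if "u \<in> U" "s \<in> T" "w \<in> W" "edge u s" "edge s w" for u s w
  proof -
    let ?v = "complete_square u s w"
    have e: "edge u ?v" "edge ?v w" using complete_square_edges that by auto
    have "?v \<in> S"
    proof (rule ccontr)
      assume "?v \<notin> S"
      then have "reach edge V0 S ?v" using e that by (auto simp: U_def intro: reach.step)
      moreover have "reach edge\<inverse>\<inverse> V1 S ?v"
        using e that \<open>?v \<notin> S\<close> by (auto simp: W_def intro: reach.step)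
      ultimately show False using cutset_not_both[OF cut] by blast
    qed
    moreover have "card (fst ?v) = card (fst s)"
      using edge_card[of u "complete_square u s w"] edge_card[of u s] e(1) that(1,4) UV by auto
    ultimately show ?thesis using that by (auto simp: T_def)
  qed
  have "sum wt U \<le> sum wt T"
  proof (rule middle_layer_weight)
    show "finite U" "finite T" "finite W"
      using finite_subset[OF _ finite_V] UV TV WV by blast+
    show "0 < wt v" for v by (rule wt_pos)
  next
    fix R assume R: "R \<subseteq> T"
    have "cutset edge V0 V1 (S - R \<union> {u. reach edge V0 S u \<and> (\<exists>s\<in>R. edge u s)})"
      by (rule cutset_push) (use cut R T0 in auto)
    moreover have "{u. reach edge V0 S u \<and> (\<exists>s\<in>R. edge u s)} = {u \<in> U. \<exists>s\<in>R. edge u s}"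
      using R by (auto simp: U_def)
    ultimately show "sum wt R \<le> sum wt {u \<in> U. \<exists>s\<in>R. edge u s}"
      using R TS UV by (intro min_cut_push_weight[OF S]) auto
    \<comment> \<open>The upward push is the downward push in the converse graph, where the roles of
      \<open>V0\<close> and \<open>V1\<close> are exchanged.\<close>
    have "cutset edge\<inverse>\<inverse> V1 V0 (S - R \<union> {u. reach edge\<inverse>\<inverse> V1 S u \<and> (\<exists>s\<in>R. edge\<inverse>\<inverse> u s)})"
      by (rule cutset_push) (use cutset_converse[OF cut] R T1 in auto)
    then have "cutset edge V0 V1 (S - R \<union> {u. reach edge\<inverse>\<inverse> V1 S u \<and> (\<exists>s\<in>R. edge\<inverse>\<inverse> u s)})"
      using cutset_converse by fastforce
    moreover have "{u. reach edge\<inverse>\<inverse> V1 S u \<and> (\<exists>s\<in>R. edge\<inverse>\<inverse> u s)} = {w \<in> W. \<exists>s\<in>R. edge s w}"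
      using R by (auto simp: W_def)
    ultimately show "sum wt R \<le> sum wt {w \<in> W. \<exists>s\<in>R. edge s w}"
      using R TS WV by (intro min_cut_push_weight[OF S]) auto
  next
    fix u s assume us: "u \<in> U" "s \<in> T" "edge u s"
    show "card {w \<in> W. edge s w} \<le> card {v \<in> T. edge u v}"
    proof (rule card_inj_on_le)
      show "inj_on (complete_square u s) {w \<in> W. edge s w}"
        using complete_square_inj_up[OF us(3)] by (rule inj_on_subset) auto
      show "complete_square u s ` {w \<in> W. edge s w} \<subseteq> {v \<in> T. edge u v}"
        using us square_in_T complete_square_edges by blast
      show "finite {v \<in> T. edge u v}" using TV by (intro finite_subset[OF _ finite_V]) auto
    qed
  next
    fix s w assume sw: "s \<in> T" "w \<in> W" "edge s w"
    let ?c = "\<lambda>u. complete_square u s w"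
    have "(\<Sum>u | u \<in> U \<and> edge u s. wt u / wt s) = (\<Sum>u | u \<in> U \<and> edge u s. wt (?c u) / wt w)"
      using UV sw by (intro sum.cong) (auto simp: complete_square_wt)
    also have "\<dots> = (\<Sum>v\<in>?c ` {u. u \<in> U \<and> edge u s}. wt v / wt w)"
      by (subst sum.reindex[OF inj_on_subset[OF complete_square_inj_down[OF sw(3)]]]) auto
    also have "\<dots> \<le> (\<Sum>v | v \<in> T \<and> edge v w. wt v / wt w)"
    proof (rule sum_mono2)
      show "finite {v. v \<in> T \<and> edge v w}" using TV by (intro finite_subset[OF _ finite_V]) auto
      show "?c ` {u. u \<in> U \<and> edge u s} \<subseteq> {v. v \<in> T \<and> edge v w}"
        using sw square_in_T complete_square_edges by blast
    qed (simp add: wt_pos less_imp_le)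
    finally show "(\<Sum>u | u \<in> U \<and> edge u s. wt u / wt s) \<le> (\<Sum>v | v \<in> T \<and> edge v w. wt v / wt w)" .
  qed (auto simp: U_def W_def)
  moreover have "sum wt (S - T \<union> U) \<le> sum wt S - sum wt T + sum wt U"
  proof -
    have fin: "finite S" "finite U" using finite_subset[OF _ finite_V] SV UV by blast+
    have "sum wt (S - T \<union> U) \<le> sum wt (S - T) + sum wt U"
      using fin wt_pos[THEN less_imp_le] by (subst sum_Un) (auto intro: sum_nonneg)
    then show ?thesis using fin TS by (simp add: sum_diff)
  qed
  ultimately have "sum wt (S - T \<union> U) \<le> sum wt S" by simp
  moreover have "cutset edge V0 V1 (S - T \<union> U)"
    unfolding U_def by (rule cutset_push) (use cut T0 in auto)
  moreover have "S - T \<union> U \<subseteq> V" using SV UV by auto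
  moreover have "sum wt S \<le> sum wt S'" if "S' \<subseteq> V" "cutset edge V0 V1 S'" for S'
    using S that by (simp add: min_cut_def)
  ultimately show ?thesis unfolding min_cut_def by (blast intro: order_trans)
qed

text \<open>Middle layers are emptied from the top down, each being pushed one layer lower.\<close>

lemma min_cut_extreme: "\<exists>S. min_cut S \<and> (\<forall>s\<in>S. fst s = {} \<or> fst s = K)"
proof -
  \<comment> \<open>After n rounds the middle vertices of S have level at most
    \<open>card K - n\<close>. The round from 0 to 1 only uses that K is the sole subset of full
    size; once the truncated difference is 0, only the empty set is left at that level.\<close>
  have "\<exists>S. min_cut S \<and> (\<forall>s\<in>S. fst s = {} \<or> fst s = K \<or> card (fst s) < Suc (card K - n))" for n
  proof (induction n)
    case 0
    obtain S where S: "min_cut S" using min_cut_exists by blast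
    have "card (fst s) < Suc (card K)" if "s \<in> V" for s
      using fst_V[OF that] finite_K by (simp add: card_mono less_Suc_eq_le)
    then have "\<forall>s\<in>S. card (fst s) < Suc (card K - 0)" using S unfolding min_cut_def by auto
    then show ?case using S by blast
  next
    case (Suc n)
    then obtain S where S: "min_cut S"
      and lev: "\<forall>s\<in>S. fst s = {} \<or> fst s = K \<or> card (fst s) < Suc (card K - n)" by blast
    define j where "j = card K - n"
    show ?case
    proof (cases "0 < j \<and> n \<noteq> 0")
      case True
      define T where "T = {s \<in> S. card (fst s) = j}"
      define U where "U = {u. reach edge V0 S u \<and> (\<exists>s\<in>T. edge u s)}"
      have "min_cut (S - T \<union> U)"
        unfolding T_def U_def by (rule min_cut_push_level) (use S True in \<open>auto simp: j_def\<close>)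
      moreover have "fst s = {} \<or> fst s = K \<or> card (fst s) < Suc (card K - Suc n)"
        if "s \<in> S - T \<union> U" for s
      proof (cases "s \<in> U")
        case sU: True
        then obtain t where "t \<in> T" "edge s t" "s \<in> V" by (auto simp: U_def reach_V)
        then have "j = Suc (card (fst s))" using edge_card by (simp add: T_def)
        then have "card (fst s) < Suc (card K - Suc n)" unfolding j_def by arith
        then show ?thesis by blast
      next
        case sU: False
        then have "s \<in> S" "card (fst s) \<noteq> j" using that by (auto simp: T_def)
        then have "fst s = {} \<or> fst s = K \<or> card (fst s) < j"
          using bspec[OF lev \<open>s \<in> S\<close>] by (auto simp: j_def)
        then show ?thesis using True by (auto simp: j_def)
      qed
      ultimately show ?thesis by blast
    next
      case False
      have "fst s = {} \<or> fst s = K \<or> card (fst s) < Suc (card K - Suc n)" if "s \<in> S" for s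
      proof -
        have V: "s \<in> V" using S that by (auto simp: min_cut_def)
        show ?thesis
        proof (cases "n = 0")
          case True
          have "fst s = K \<or> card (fst s) < card K"
            using psubset_card_mono[OF finite_K, of "fst s"] fst_V[OF V] by blast
          then show ?thesis using True by auto
        next
          case n: False
          then have "card K - n = 0" using False by (simp add: j_def)
          then have "fst s = {} \<or> fst s = K \<or> card (fst s) = 0"
            using bspec[OF lev that] by simp
          then show ?thesis using finite_fst_V[OF V] card_0_eq by blast
        qed
      qed
      then show ?thesis using S by blast
    qed
  qed
  from this[of "card K"] obtain S where S: "min_cut S"
    and lev: "\<forall>s\<in>S. fst s = {} \<or> fst s = K \<or> card (fst s) < 1" by auto
  have "fst s = {} \<or> fst s = K" if "s \<in> S" for s
  proof -
    have "finite (fst s)" using finite_fst_V[of s] S that by (auto simp: min_cut_def)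
    then show ?thesis using bspec[OF lev that] by (auto simp: card_eq_0_iff)
  qed
  then show ?thesis using S by blast
qed

text \<open>Let X be the part of the bottom layer missed by an extreme minimal cutset. Nothing in
  the middle stops paths from X, so the cutset contains all of X + B_K in the top layer. By
  \<open>magn\<close> that part weighs at least |X|, so the whole cutset weighs at least |A|. Level
  l is another cutset, hence at least as heavy.\<close>

theorem weighted_pluennecke:
  assumes magn: "\<And>X. X \<subseteq> A \<Longrightarrow> real (card X) \<le> (\<Prod>i\<in>K. x i) * real (card (shifted X B K))"
    and l: "0 < l" "l \<le> card K"
  shows "real (card A) \<le> (\<Sum>L | L \<subseteq> K \<and> card L = l. (\<Prod>i\<in>L. x i) * real (card (shifted A B L)))"
proof -
  have "K \<noteq> {}" using l by auto
  obtain S where S: "min_cut S" and ext: "\<forall>s\<in>S. fst s = {} \<or> fst s = K"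
    using min_cut_extreme by blast
  have SV: "S \<subseteq> V" and cut: "cutset edge V0 V1 S" using S by (auto simp: min_cut_def)
  define X where "X = {a \<in> A. ({}, a) \<notin> S}"
  have XA: "X \<subseteq> A" by (auto simp: X_def)
  have reach_I: "I \<subset> K \<Longrightarrow> v \<in> shifted X B I \<Longrightarrow> reach edge V0 S (I, v)" if "finite I" for I v
    using that
  proof (induction I arbitrary: v)
    case empty
    then show ?case by (auto simp: X_def V0_def intro: reach.source)
  next
    case (insert i I)
    then obtain w b where w: "w \<in> shifted X B I" "b \<in> B i" "v = w + b"
      by (auto simp: shifted_insert sumset_def[of "shifted X B I"])
    have "reach edge V0 S (I, w)" using insert w by auto
    moreover have "edge (I, w) (insert i I, v)" using insert w by (auto simp: edge_def)
    moreover have "(insert i I, v) \<notin> S" using ext insert.prems by auto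
    ultimately show ?case by (rule reach.step)
  qed
  have top: "(K, v) \<in> S" if v: "v \<in> shifted X B K" for v
  proof (rule ccontr)
    assume nS: "(K, v) \<notin> S"
    obtain i where i: "i \<in> K" using \<open>K \<noteq> {}\<close> by auto
    then have "K = insert i (K - {i})" by auto
    then have "v \<in> sumset (shifted X B (K - {i})) (B i)"
      using v shifted_insert[of "K - {i}" i X B] finite_K by auto
    then obtain w b where w: "w \<in> shifted X B (K - {i})" "b \<in> B i" "v = w + b"
      by (auto simp: sumset_def[of "shifted X B (K - {i})"])
    have "reach edge V0 S (K - {i}, w)" using i finite_K by (intro reach_I w) auto
    moreover have "edge (K - {i}, w) (K, v)" using i w by (auto simp: edge_def)
    ultimately have "reach edge V0 S (K, v)" using nS by (rule reach.step)
    moreover have "(K, v) \<in> V1"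
      using v sumset_mono[OF XA] by (auto simp: V1_def)
    ultimately show False using cut by (auto simp: cutset_def)
  qed
  have slice: "sum wt ({I} \<times> Y) = prod x I * real (card Y)" for I Y
  proof -
    have "sum wt ({I} \<times> Y) = (\<Sum>p\<in>{I} \<times> Y. prod x I)" by (rule sum.cong) (auto simp: wt_def)
    then show ?thesis by (simp add: card_cartesian_product_singleton)
  qed
  have finS: "finite S" using SV by (rule finite_subset[OF _ finite_V])
  have "real (card A) = real (card (A - X)) + real (card X)"
    using XA finite_A finite_subset[OF XA] by (simp add: card_Diff_subset card_mono)
  also have "\<dots> \<le> real (card (A - X)) + (\<Prod>i\<in>K. x i) * real (card (shifted X B K))"
    using magn[OF XA] by simp
  also have "\<dots> = sum wt ({{}} \<times> (A - X)) + sum wt ({K} \<times> shifted X B K)"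
    by (simp add: slice)
  also have "\<dots> = sum wt ({{}} \<times> (A - X) \<union> {K} \<times> shifted X B K)"
    using \<open>K \<noteq> {}\<close> finite_A finite_K finite_B finite_subset[OF XA]
    by (subst sum.union_disjoint) (auto intro!: finite_shifted)
  also have "\<dots> \<le> sum wt S"
    using finS top wt_pos[THEN less_imp_le] by (intro sum_mono2) (auto simp: X_def)
  also have "\<dots> \<le> sum wt (SIGMA L:{L. L \<subseteq> K \<and> card L = l}. shifted A B L)" (is "_ \<le> sum wt ?L")
  proof -
    \<comment> \<open>Each edge raises the level by exactly 1, so a path that avoids level l never
      gets past it.\<close>
    have "card (fst p) < l" if "reach edge V0 ?L p" for p
      using that
    proof induction
      case (source v)
      then show ?case using l by (auto simp: V0_def)
    next
      case (step u v)
      have "u \<in> V" using step reach_V by blast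
      then have "v \<in> V" "card (fst v) = Suc (card (fst u))" using step edge_V edge_card by auto
      then show ?case using step by (cases v) (auto simp: V_def less_Suc_eq)
    qed
    then have "cutset edge V0 V1 ?L" using l unfolding cutset_def V1_def by force
    moreover have "?L \<subseteq> V" by (auto simp: V_def)
    ultimately show ?thesis using S by (auto simp: min_cut_def)
  qed
  also have "\<dots> = (\<Sum>L | L \<subseteq> K \<and> card L = l. \<Sum>v\<in>shifted A B L. wt (L, v))"
    using finite_K finite_A finite_B
    by (subst sum.Sigma) (auto intro!: finite_shifted intro: finite_subset[of _ K] simp: case_prod_beta')
  also have "\<dots> = (\<Sum>L | L \<subseteq> K \<and> card L = l. (\<Prod>i\<in>L. x i) * real (card (shifted A B L)))"
    by (simp add: wt_def mult.commute)
  finally show ?thesis .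
qed

end

section \<open>Pluennecke's inequality up to a constant\<close>

definition growth :: "'a::ab_group_add set \<Rightarrow> (nat \<Rightarrow> 'a set) \<Rightarrow> nat set \<Rightarrow> real" where
  "growth A B I = real (card (shifted A B I)) / real (card A)"

text \<open>Nonempty summands make all growth factors positive, so that they can serve as weights.
  An empty summand is treated separately in \<open>theorem9\<close>.\<close>

definition admissible :: "'a::ab_group_add set \<Rightarrow> (nat \<Rightarrow> 'a set) \<Rightarrow> nat set \<Rightarrow> bool" where
  "admissible A B K \<longleftrightarrow> finite A \<and> A \<noteq> {} \<and> (\<forall>i\<in>K. finite (B i) \<and> B i \<noteq> {})"

lemma admissible_subset:
  "admissible A B K \<Longrightarrow> X \<subseteq> A \<Longrightarrow> X \<noteq> {} \<Longrightarrow> I \<subseteq> K \<Longrightarrow> admissible X B I"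
  by (auto simp: admissible_def intro: finite_subset[of X A])

lemma growth_nonneg: "0 \<le> growth A B I"
  by (simp add: growth_def)

lemma growth_pos:
  assumes "finite K" "admissible A B K" "I \<subseteq> K"
  shows "0 < growth A B I"
proof -
  have "finite I" using assms finite_subset by blast
  then have "finite (shifted A B I)"
    using assms by (intro finite_shifted) (auto simp: admissible_def)
  moreover have "shifted A B I \<noteq> {}"
    using assms by (intro shifted_nonempty) (auto simp: admissible_def)
  ultimately show ?thesis using assms by (simp add: growth_def admissible_def card_gt_0_iff)
qed

lemma card_shifted_eq_growth:
  "finite A \<Longrightarrow> A \<noteq> {} \<Longrightarrow> real (card (shifted A B I)) = growth A B I * real (card A)"
  by (simp add: growth_def)

lemma growth_subset:
  assumes "finite K" "admissible A B K" "I \<subseteq> K" "X \<subseteq> A" "X \<noteq> {}"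
    and c: "real (card A) \<le> c * real (card X)"
  shows "growth X B I \<le> c * growth A B I"
proof -
  have fin: "finite A" "finite X" "A \<noteq> {}" using assms by (auto simp: admissible_def intro: finite_subset[of X A])
  have "finite (shifted A B I)"
    using assms by (intro finite_shifted) (auto simp: admissible_def intro: finite_subset[of I K])
  then have "card (shifted X B I) \<le> card (shifted A B I)"
    using assms by (intro card_mono sumset_mono)
  then have "growth X B I \<le> real (card (shifted A B I)) / real (card X)"
    by (simp add: growth_def divide_right_mono)
  also have "\<dots> = real (card A) / real (card X) * growth A B I"
    using fin by (simp add: growth_def)
  also have "\<dots> \<le> c * growth A B I"
    using fin assms(5) c by (intro mult_right_mono growth_nonneg) (simp add: divide_le_eq card_gt_0_iff)
  finally show ?thesis .
qed

text \<open>The weights \<open>x\<^sub>i\<close> are chosen so that all \<open>(\<Prod>j\<in>K-{i}. x\<^sub>j) |A + B\<^bsub>K-{i}\<^esub>|\<close> coincide and \<open>\<Prod>j\<in>K. x\<^sub>j\<close> is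
  the inverse of the bound to be proved.\<close>

lemma pluennecke_codim_one:
  assumes K: "finite K" "card K = Suc n" and n: "0 < n" and adm: "admissible A B K"
  shows "\<exists>X\<subseteq>A. X \<noteq> {} \<and>
    growth X B K \<le> real (n + 2) ^ Suc n * (\<Prod>i\<in>K. growth A B (K - {i})) powr (1 / n)"
proof (rule ccontr)
  assume neg: "\<not> ?thesis"
  \<comment> \<open>The comparison below leads to n + 1 terms |A| / D^n with sum at least |A|. A
    contradiction needs D^n > n + 1, which D = n + 2 ensures.\<close>
  define D where "D = real (n + 2)"
  define P where "P = (\<Prod>i\<in>K. growth A B (K - {i}))"
  define \<gamma> where "\<gamma> = P powr (1 / n)"
  define t where "t = 1 / (D * \<gamma>)"
  define x where "x = (\<lambda>i. if i \<in> K then growth A B (K - {i}) * t else 1)"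
  have fin: "finite A" "A \<noteq> {}" using adm by (auto simp: admissible_def)
  have gpos: "0 < growth A B (K - {i})" for i using growth_pos[OF K(1) adm] by auto
  have P: "0 < P" unfolding P_def using gpos by (simp add: prod_pos)
  then have \<gamma>: "0 < \<gamma>" "\<gamma> ^ n = P"
    using n powr_realpow[of \<gamma> n] by (simp_all add: \<gamma>_def powr_powr)
  have D: "0 < D" by (simp add: D_def)
  have t: "0 < t" using D \<gamma> by (simp add: t_def)
  have prodx: "prod x K = 1 / (D ^ Suc n * \<gamma>)"
  proof -
    have "prod x K = P * t ^ Suc n"
      using K by (simp add: x_def P_def prod.distrib)
    also have "\<dots> = 1 / (D ^ Suc n * \<gamma>)" 
      unfolding \<gamma>(2)[symmetric] t_def using \<gamma>(1) D by (simp add: power_divide power_mult_distrib)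
    finally show ?thesis .
  qed
  have "0 < x i" for i using t gpos[of i] by (simp add: x_def)
  moreover have "finite (B i)" if "i \<in> K" for i using adm that by (simp add: admissible_def)
  ultimately have graph: "sumset_graph A B K x"
    using K(1) fin(1) by (intro sumset_graph.intro)
  have "real (card A) \<le> (\<Sum>L | L \<subseteq> K \<and> card L = n. prod x L * real (card (shifted A B L)))"
  proof (rule sumset_graph.weighted_pluennecke[OF graph])
    fix X assume X: "X \<subseteq> A"
    \<comment> \<open>For nonempty X this is the negated claim, since \<open>prod x K\<close> is the
      inverse of the claimed bound.\<close>
    show "real (card X) \<le> prod x K * real (card (shifted X B K))"
    proof (cases "X = {}")
      case False
      then have "\<not> growth X B K \<le> D ^ Suc n * \<gamma>"
        using neg X unfolding D_def \<gamma>_def P_def by blast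
      then have "D ^ Suc n * \<gamma> < growth X B K" by simp
      moreover have "0 < card X" using X False fin by (auto simp: card_gt_0_iff intro: finite_subset[of X A])
      moreover have "0 < D ^ Suc n * \<gamma>" using D \<gamma> by simp
      ultimately show ?thesis unfolding prodx growth_def by (simp add: field_simps)
    qed (use D \<gamma> in \<open>simp add: prodx\<close>)
  qed (use n K in auto)
  also have "{L. L \<subseteq> K \<and> card L = n} = (\<lambda>i. K - {i}) ` K"
  proof (intro equalityI subsetI)
    fix L assume "L \<in> {L. L \<subseteq> K \<and> card L = n}"
    then have L: "L \<subseteq> K" "card L = n" by auto
    then have "card (K - L) = 1" using K card_Diff_subset[of L K] finite_subset[of L K] by simp
    then obtain i where "K - L = {i}" by (auto simp: card_1_singleton_iff)
    then have "i \<in> K" "L = K - {i}" using L by auto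
    then show "L \<in> (\<lambda>i. K - {i}) ` K" by auto
  qed (use K in auto)
  also have "(\<Sum>L\<in>(\<lambda>i. K - {i}) ` K. prod x L * real (card (shifted A B L))) =
      (\<Sum>i\<in>K. prod x (K - {i}) * real (card (shifted A B (K - {i}))))"
    by (subst sum.reindex) (auto simp: inj_on_def)
  also have "\<dots> = (\<Sum>i\<in>K. real (card A) / D ^ n)"
  proof (rule sum.cong)
    fix i assume i: "i \<in> K"
    have "x i * prod x (K - {i}) = 1 / (D ^ Suc n * \<gamma>)"
      using i K prodx by (simp add: prod.remove)
    moreover have "x i = growth A B (K - {i}) / (D * \<gamma>)" using i by (simp add: x_def t_def)
    ultimately have "growth A B (K - {i}) * prod x (K - {i}) = 1 / D ^ n"
      using D \<gamma> by (simp add: field_simps)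
    then show "prod x (K - {i}) * real (card (shifted A B (K - {i}))) = real (card A) / D ^ n"
      by (simp add: card_shifted_eq_growth[OF fin] mult.assoc[symmetric] mult.commute[of "prod x _"])
  qed simp
  also have "\<dots> = real (card A) * (real (Suc n) / D ^ n)" using K by simp
  finally have "real (card A) * 1 \<le> real (card A) * (real (Suc n) / D ^ n)" by simp
  moreover have "0 < real (card A)" using fin by (simp add: card_gt_0_iff)
  ultimately have "1 \<le> real (Suc n) / D ^ n" by (simp only: mult_le_cancel_left_pos)
  then have "D ^ n \<le> real (Suc n)" using D by (simp add: field_simps)
  moreover have "D ^ 1 \<le> D ^ n" using n by (intro power_increasing) (auto simp: D_def)
  ultimately show False by (simp add: D_def)
qed

text \<open>Repeatedly removing a set with small sumset; \<open>G\<close> plays the role of a primitive of the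
  increasing function \<open>f\<close>, integral or sum.\<close>

lemma greedy_union:
  fixes f G :: "real \<Rightarrow> real" and t :: real
  assumes A: "finite A" and t: "0 \<le> t" "t < real (card A)"
    and ex: "\<And>A'. A' \<subseteq> A \<Longrightarrow> real (card A) - real (card A') \<le> t \<Longrightarrow>
      \<exists>X\<subseteq>A'. X \<noteq> {} \<and> real (card (sumset X Z)) \<le> f (real (card A) - real (card A')) * real (card X)"
    and G0: "0 \<le> G 0"
    and G: "\<And>(r::nat) s. real r \<le> s \<Longrightarrow> s \<le> t \<Longrightarrow> s \<in> \<nat> \<or> s = t \<Longrightarrow>
      G (real r) + (s - real r) * f (real r) \<le> G s"
    and f: "\<And>r::nat. real r \<le> t \<Longrightarrow> f (real r) \<le> f t"
  shows "\<exists>X\<subseteq>A. t < real (card X) \<and>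
    real (card (sumset X Z)) \<le> G t + (real (card X) - t) * f t"
proof -
  have grow: "\<exists>X\<subseteq>A. t < real (card X) \<and>
      real (card (sumset X Z)) \<le> G t + (real (card X) - t) * f t"
    if "X \<subseteq> A" "real (card X) \<le> t" "real (card (sumset X Z)) \<le> G (real (card X))" for X
    using that
  proof (induction "card A - card X" arbitrary: X rule: less_induct)
    case less
    define r where "r = card X"
    have r: "real r \<le> t" using less.prems by (simp add: r_def)
    have finX: "finite X" using less.prems A finite_subset by blast
    have cD: "real (card A) - real (card (A - X)) = real r"
      using less.prems finX A by (simp add: card_Diff_subset card_mono r_def of_nat_diff)
    obtain Y where Y: "Y \<subseteq> A - X" "Y \<noteq> {}" "real (card (sumset Y Z)) \<le> f (real r) * real (card Y)"
      using ex[of "A - X"] cD r by auto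
    define X' where "X' = X \<union> Y"
    have finY: "finite Y" using Y A by (meson finite_Diff finite_subset)
    have card': "card X' = r + card Y"
      unfolding X'_def r_def using finX finY Y by (intro card_Un_disjoint) auto
    have Ypos: "0 < card Y" using Y finY by (simp add: card_gt_0_iff)
    have X'A: "X' \<subseteq> A" using Y less.prems by (auto simp: X'_def)
    have "card (sumset X' Z) \<le> card (sumset X Z) + card (sumset Y Z)"
      unfolding X'_def sumset_Un by (rule card_Un_le)
    then have le: "real (card (sumset X' Z)) \<le> G (real r) + f (real r) * real (card Y)"
      using less.prems(3) Y(3) by (simp add: r_def)
    show ?case
    proof (cases "real (card X') \<le> t")
      case True
      \<comment> \<open>Adding Y costs at most |Y| f(r), which the increase of G from r to |X'|
        absorbs. The target |X'| is a natural number here and t in the other case, whence the two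
        alternatives allowed for s.\<close>
      have "G (real r) + (real (card X') - real r) * f (real r) \<le> G (real (card X'))"
        using True card' by (intro G) auto
      then have "real (card (sumset X' Z)) \<le> G (real (card X'))"
        using le card' by (simp add: mult.commute)
      moreover have "card A - card X' < card A - card X"
        using card' Ypos card_mono[OF A X'A] by (simp add: r_def)
      ultimately show ?thesis using less.hyps X'A True by blast
    next
      case False
      \<comment> \<open>The last piece overshoots t: its share up to t is absorbed by G, the excess
        is charged at rate f t.\<close>
      have "G (real r) + (t - real r) * f (real r) \<le> G t" using r by (intro G) auto
      moreover have "(real (card X') - t) * f (real r) \<le> (real (card X') - t) * f t"
        using f[OF r] False by (intro mult_left_mono) auto
      ultimately have "real (card (sumset X' Z)) \<le> G t + (real (card X') - t) * f t"
        using le card' by (simp add: algebra_simps)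
      then show ?thesis using X'A False by auto
    qed
  qed
  have "sumset {} Z = {}" by (simp add: sumset_def)
  then show ?thesis using grow[of "{}"] t G0 by simp
qed

text \<open>As long as at most half of A has been removed, the growth factors of the rest are at
  most doubled. The n + 1 doubled factors account for the additional constant; the rate f is
  constant and G is linear.\<close>

lemma pluennecke_codim_one_large:
  assumes K: "finite K" "card K = Suc n" and n: "0 < n" and adm: "admissible A B K"
  shows "\<exists>X\<subseteq>A. X \<noteq> {} \<and> real (card A) \<le> 2 * real (card X) \<and>
    growth X B K \<le> real (n + 2) ^ Suc n * (2 ^ Suc n) powr (1 / n) *
      (\<Prod>i\<in>K. growth A B (K - {i})) powr (1 / n)"
proof -
  define C where "C = real (n + 2) ^ Suc n * (2 ^ Suc n) powr (1 / n) *
    (\<Prod>i\<in>K. growth A B (K - {i})) powr (1 / n)"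
  have fin: "finite A" "A \<noteq> {}" using adm by (auto simp: admissible_def)
  then have cA: "0 < card A" by (simp add: card_gt_0_iff)
  have "\<exists>X\<subseteq>A. real (card A) / 2 < real (card X) \<and> real (card (sumset X (sumset_fam B K)))
      \<le> C * (real (card A) / 2) + (real (card X) - real (card A) / 2) * C"
  proof (rule greedy_union[where f = "\<lambda>_. C" and G = "\<lambda>s. C * s"])
    fix A' assume A': "A' \<subseteq> A" "real (card A) - real (card A') \<le> real (card A) / 2"
    then have "A' \<noteq> {}" using cA by auto
    then have adm': "admissible A' B K" using admissible_subset[OF adm] A' by auto
    obtain X where X: "X \<subseteq> A'" "X \<noteq> {}"
      "growth X B K \<le> real (n + 2) ^ Suc n * (\<Prod>i\<in>K. growth A' B (K - {i})) powr (1 / n)"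
      using pluennecke_codim_one[OF K n adm'] by blast
    have "(\<Prod>i\<in>K. growth A' B (K - {i})) \<le> (\<Prod>i\<in>K. 2 * growth A B (K - {i}))"
      using A' \<open>A' \<noteq> {}\<close> K adm by (intro prod_mono conjI growth_nonneg growth_subset) auto
    also have "\<dots> = 2 ^ Suc n * (\<Prod>i\<in>K. growth A B (K - {i}))"
      using K by (simp add: prod.distrib)
    finally have "(\<Prod>i\<in>K. growth A' B (K - {i})) powr (1 / n)
        \<le> (2 ^ Suc n * (\<Prod>i\<in>K. growth A B (K - {i}))) powr (1 / n)"
      by (intro powr_mono2) (auto intro: prod_nonneg growth_nonneg)
    also have "\<dots> = (2 ^ Suc n) powr (1 / n) * (\<Prod>i\<in>K. growth A B (K - {i})) powr (1 / n)"
      by (rule powr_mult)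
    finally have "real (n + 2) ^ Suc n * (\<Prod>i\<in>K. growth A' B (K - {i})) powr (1 / n) \<le> C"
      unfolding C_def mult.assoc by (intro mult_left_mono) auto
    then have "growth X B K \<le> C" using X by simp
    moreover have "finite X" using X A' fin by (meson finite_subset)
    ultimately have "real (card (shifted X B K)) \<le> C * real (card X)"
      using card_shifted_eq_growth[of X B K] X by (simp add: mult_right_mono)
    then show "\<exists>X\<subseteq>A'. X \<noteq> {} \<and> real (card (shifted X B K)) \<le> C * real (card X)"
      using X by blast
  qed (use fin cA in \<open>auto simp: algebra_simps\<close>)
  then obtain X where X: "X \<subseteq> A" "real (card A) / 2 < real (card X)"
    "real (card (shifted X B K)) \<le> C * real (card X)" by (auto simp: algebra_simps)
  then have "0 < real (card X)" using cA by linarith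
  then have "X \<noteq> {}" "growth X B K \<le> C" using X by (auto simp: growth_def divide_le_eq)
  then show ?thesis using X unfolding C_def by (intro exI[of _ X]) auto
qed

text \<open>The sets I are handled one after another. Passing to a subset of positive proportion
  worsens by a constant both the bounds already obtained and the growth factors entering the next
  one. The constant is quantified before A and B, as the tensor power trick requires.\<close>

lemma pluennecke_codim_one_simultaneous:
  fixes n :: nat
  assumes "finite \<I>" "finite K" "0 < n" and "\<And>I. I \<in> \<I> \<Longrightarrow> I \<subseteq> K \<and> card I = Suc n"
  shows "\<exists>c\<ge>1. \<forall>(A::'a::ab_group_add set) B. admissible A B K \<longrightarrow>
    (\<exists>X\<subseteq>A. X \<noteq> {} \<and> real (card A) \<le> c * real (card X) \<and>
      (\<forall>I\<in>\<I>. growth X B I \<le> c * (\<Prod>i\<in>I. growth A B (I - {i})) powr (1 / n)))"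
  using assms(1,4)
proof (induction \<I>)
  case empty
  show ?case by (rule exI[of _ 1]) (auto simp: admissible_def)
next
  case (insert I \<I>)
  then obtain c where c: "1 \<le> c" and X: "\<And>(A::'a set) B. admissible A B K \<Longrightarrow>
    (\<exists>X\<subseteq>A. X \<noteq> {} \<and> real (card A) \<le> c * real (card X) \<and>
      (\<forall>I\<in>\<I>. growth X B I \<le> c * (\<Prod>i\<in>I. growth A B (I - {i})) powr (1 / n)))"
    by auto
  have I: "I \<subseteq> K" "card I = Suc n" "finite I" using insert.prems finite_subset[OF _ assms(2)] by auto
  define d where "d = real (n + 2) ^ Suc n * (2 ^ Suc n) powr (1 / n)"
  have d: "0 \<le> d" by (simp add: d_def)
  \<comment> \<open>The first entry covers the size of the subset and the older sets; the second
    covers the new set I, whose n + 1 growth factors have each grown by at most c.\<close>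
  define c' where "c' = max (2 * c) (d * (c ^ Suc n) powr (1 / n))"
  have "\<exists>X\<subseteq>A. X \<noteq> {} \<and> real (card A) \<le> c' * real (card X) \<and>
      (\<forall>I\<in>insert I \<I>. growth X B I \<le> c' * (\<Prod>i\<in>I. growth A B (I - {i})) powr (1 / n))"
    if adm: "admissible A B K" for A :: "'a set" and B
  proof -
    obtain X where X: "X \<subseteq> A" "X \<noteq> {}" "real (card A) \<le> c * real (card X)"
      and XI: "\<forall>I\<in>\<I>. growth X B I \<le> c * (\<Prod>i\<in>I. growth A B (I - {i})) powr (1 / n)"
      using X[OF adm] by blast
    have admX: "admissible X B K" using admissible_subset[OF adm] X by auto
    then have "admissible X B I" using I admissible_subset[of X B K X I] X by auto
    then obtain Y where Y: "Y \<subseteq> X" "Y \<noteq> {}" "real (card X) \<le> 2 * real (card Y)"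
      and YI: "growth Y B I \<le> d * (\<Prod>i\<in>I. growth X B (I - {i})) powr (1 / n)"
      using pluennecke_codim_one_large[OF I(3,2) assms(3)] unfolding d_def by blast
    have "c * real (card X) \<le> c * (2 * real (card Y))" using c Y by (intro mult_left_mono) auto
    then have "real (card A) \<le> (2 * c) * real (card Y)" using X by simp
    also have "\<dots> \<le> c' * real (card Y)" by (intro mult_right_mono) (auto simp: c'_def)
    finally have AY: "real (card A) \<le> c' * real (card Y)" .
    have "growth Y B J \<le> c' * (\<Prod>i\<in>J. growth A B (J - {i})) powr (1 / n)"
      if "J \<in> insert I \<I>" for J
    proof (cases "J = I")
      case True
      have "(\<Prod>i\<in>I. growth X B (I - {i})) \<le> (\<Prod>i\<in>I. c * growth A B (I - {i}))"
        using X I adm assms(2) by (intro prod_mono conjI growth_nonneg growth_subset[of K]) auto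
      also have "\<dots> = c ^ Suc n * (\<Prod>i\<in>I. growth A B (I - {i}))"
        using I by (simp add: prod.distrib)
      finally have "(\<Prod>i\<in>I. growth X B (I - {i})) powr (1 / n)
          \<le> (c ^ Suc n * (\<Prod>i\<in>I. growth A B (I - {i}))) powr (1 / n)"
        by (intro powr_mono2) (auto intro: prod_nonneg growth_nonneg)
      also have "\<dots> = (c ^ Suc n) powr (1 / n) * (\<Prod>i\<in>I. growth A B (I - {i})) powr (1 / n)"
        by (rule powr_mult)
      finally have "d * (\<Prod>i\<in>I. growth X B (I - {i})) powr (1 / n)
          \<le> d * ((c ^ Suc n) powr (1 / n) * (\<Prod>i\<in>I. growth A B (I - {i})) powr (1 / n))"
        using d by (intro mult_left_mono)
      also have "\<dots> \<le> c' * (\<Prod>i\<in>I. growth A B (I - {i})) powr (1 / n)"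
        unfolding mult.assoc[symmetric] by (intro mult_right_mono) (auto simp: c'_def)
      finally show ?thesis using YI True by simp
    next
      case False
      then have J: "J \<in> \<I>" "J \<subseteq> K" using that insert.prems by auto
      have "growth Y B J \<le> 2 * growth X B J"
        using Y J admX assms(2) by (intro growth_subset[of K]) auto
      also have "\<dots> \<le> 2 * (c * (\<Prod>i\<in>J. growth A B (J - {i})) powr (1 / n))"
        using XI J by simp
      also have "\<dots> \<le> c' * (\<Prod>i\<in>J. growth A B (J - {i})) powr (1 / n)"
        unfolding mult.assoc[symmetric] by (intro mult_right_mono) (auto simp: c'_def)
      finally show ?thesis .
    qed
    then show ?thesis using AY X Y by (intro exI[of _ Y]) auto
  qed
  moreover have "1 \<le> c'" using c by (simp add: c'_def)
  ultimately show ?case by blast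
qed

text \<open>The exponent \<open>1 / ((|J| - 1) choose (l - 1))\<close> is \<open>(l - 1)! (k - l)! / (k - 1)!\<close> for \<open>|J| = k\<close>.\<close>

definition mean_growth :: "'a::ab_group_add set \<Rightarrow> (nat \<Rightarrow> 'a set) \<Rightarrow> nat \<Rightarrow> nat set \<Rightarrow> real" where
  "mean_growth A B l J = (\<Prod>L | L \<subseteq> J \<and> card L = l. growth A B L) powr
     (1 / real ((card J - 1) choose (l - 1)))"

text \<open>Each l-subset L of J lies in J - {i} for exactly j + 1 - l indices i, and the absorption
  identity for binomial coefficients turns the resulting exponent into 1 / (j choose (l-1)).\<close>

lemma mean_growth_step:
  assumes J: "finite J" "card J = Suc j" and l: "0 < l" "l \<le> j"
  shows "(\<Prod>i\<in>J. mean_growth A B l (J - {i})) powr (1 / j) = mean_growth A B l J"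
proof -
  define P where "P = (\<Prod>L | L \<subseteq> J \<and> card L = l. growth A B L)"
  have P0: "0 \<le> P" unfolding P_def by (intro prod_nonneg) (auto simp: growth_nonneg)
  have "(\<Prod>i\<in>J. \<Prod>L | L \<subseteq> J - {i} \<and> card L = l. growth A B L) =
      (\<Prod>i\<in>J. \<Prod>L | L \<in> {L. L \<subseteq> J \<and> card L = l} \<and> i \<notin> L. growth A B L)"
    by (intro prod.cong) auto
  also have "\<dots> = (\<Prod>L\<in>{L. L \<subseteq> J \<and> card L = l}. \<Prod>i | i \<in> J \<and> i \<notin> L. growth A B L)"
    by (rule prod.swap_restrict) (use J in auto)
  also have "\<dots> = (\<Prod>L\<in>{L. L \<subseteq> J \<and> card L = l}. growth A B L ^ (Suc j - l))"
  proof (rule prod.cong)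
    fix L assume L: "L \<in> {L. L \<subseteq> J \<and> card L = l}"
    have "{i. i \<in> J \<and> i \<notin> L} = J - L" by auto
    then show "(\<Prod>i | i \<in> J \<and> i \<notin> L. growth A B L) = growth A B L ^ (Suc j - l)"
      using L J card_Diff_subset[of L J] finite_subset[of L J] by auto
  qed simp
  also have "\<dots> = P ^ (Suc j - l)" by (simp add: P_def prod_power_distrib)
  finally have eq: "(\<Prod>i\<in>J. \<Prod>L | L \<subseteq> J - {i} \<and> card L = l. growth A B L) = P ^ (Suc j - l)" .
  have powP: "P ^ (Suc j - l) = P powr real (Suc j - l)"
    using P0 l by (intro powr_realpow'[symmetric]) auto
  have "(\<Prod>i\<in>J. mean_growth A B l (J - {i})) =
      (\<Prod>i\<in>J. (\<Prod>L | L \<subseteq> J - {i} \<and> card L = l. growth A B L) powr (1 / real ((j - 1) choose (l - 1))))"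
    using J by (intro prod.cong) (auto simp: mean_growth_def)
  also have "\<dots> = (P ^ (Suc j - l)) powr (1 / real ((j - 1) choose (l - 1)))"
    unfolding eq[symmetric] prod_powr_distrib ..
  finally have "(\<Prod>i\<in>J. mean_growth A B l (J - {i})) powr (1 / j) =
      P powr (real (Suc j - l) * (1 / real ((j - 1) choose (l - 1))) * (1 / j))"
    unfolding powP by (simp add: powr_powr)
  also have "real (Suc j - l) * (1 / real ((j - 1) choose (l - 1))) * (1 / j) =
      1 / real (j choose (l - 1))"
  proof -
    have "Suc j - l = j - (l - 1)" using l by simp
    then have "(Suc j - l) * (j choose (l - 1)) = j * ((j - 1) choose (l - 1))"
      using binomial_absorb_comp[of j "l - 1"] by (simp only:)
    then have "real (Suc j - l) * real (j choose (l - 1)) = real j * real ((j - 1) choose (l - 1))"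
      by (metis of_nat_mult)
    moreover have "0 < (j - 1) choose (l - 1)" "0 < j choose (l - 1)" "0 < j"
      using l by (auto intro!: zero_less_binomial)
    ultimately show ?thesis by (simp add: divide_simps mult.commute)
  qed
  finally show ?thesis using J by (simp add: mean_growth_def P_def)
qed

lemma mean_growth_nonneg: "0 \<le> mean_growth A B l J"
  by (simp add: mean_growth_def)

text \<open>Induction on j, with one X for all J of size j, because the next step combines the
  bounds of all j-subsets of a larger set. By \<open>mean_growth_step\<close> these combine to the
  mean for that larger set, so only the constant changes.\<close>

lemma pluennecke_up_to_constant:
  fixes l :: nat
  assumes K: "finite K" and l: "0 < l" and j: "l \<le> j"
  shows "\<exists>c\<ge>1. \<forall>(A::'a::ab_group_add set) B. admissible A B K \<longrightarrow>
    (\<exists>X\<subseteq>A. X \<noteq> {} \<and> real (card A) \<le> c * real (card X) \<and>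
      (\<forall>J. J \<subseteq> K \<longrightarrow> card J = j \<longrightarrow> growth X B J \<le> c * mean_growth A B l J))"
  using j
proof (induction j rule: dec_induct)
  case base
  \<comment> \<open>Here J is its only l-subset and the exponent is 1, so the two sides
    agree.\<close>
  have "growth A B J \<le> mean_growth A B l J" if "J \<subseteq> K" "card J = l" for A :: "'a set" and B J
  proof -
    have "finite J" using that K finite_subset by blast
    then have "L = J" if "L \<subseteq> J" "card L = l" for L
      using that \<open>card J = l\<close> by (intro card_subset_eq) simp_all
    then have "{L. L \<subseteq> J \<and> card L = l} = {J}" using that by blast
    then show ?thesis using that by (simp add: mean_growth_def growth_nonneg)
  qed
  then have "\<exists>X\<subseteq>A. X \<noteq> {} \<and> real (card A) \<le> 1 * real (card X) \<and>
      (\<forall>J. J \<subseteq> K \<longrightarrow> card J = l \<longrightarrow> growth X B J \<le> 1 * mean_growth A B l J)"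
    if "admissible A B K" for A :: "'a set" and B
    using that unfolding admissible_def by (intro exI[of _ A]) simp
  then show ?case by (intro exI[of _ 1]) simp
next
  case (step j)
  obtain c where c: "1 \<le> c" and cX: "\<And>(A::'a set) B. admissible A B K \<Longrightarrow>
    (\<exists>X\<subseteq>A. X \<noteq> {} \<and> real (card A) \<le> c * real (card X) \<and>
      (\<forall>J. J \<subseteq> K \<longrightarrow> card J = j \<longrightarrow> growth X B J \<le> c * mean_growth A B l J))"
    using step.IH by blast
  have j0: "0 < j" using step l by simp
  have "\<exists>d\<ge>1. \<forall>(A::'a set) B. admissible A B K \<longrightarrow>
    (\<exists>X\<subseteq>A. X \<noteq> {} \<and> real (card A) \<le> d * real (card X) \<and>
      (\<forall>I\<in>{I. I \<subseteq> K \<and> card I = Suc j}.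
         growth X B I \<le> d * (\<Prod>i\<in>I. growth A B (I - {i})) powr (1 / j)))"
    by (rule pluennecke_codim_one_simultaneous) (use K j0 in auto)
  then obtain d where d: "1 \<le> d" and dX: "\<And>(A::'a set) B. admissible A B K \<Longrightarrow>
    (\<exists>X\<subseteq>A. X \<noteq> {} \<and> real (card A) \<le> d * real (card X) \<and>
      (\<forall>I\<in>{I. I \<subseteq> K \<and> card I = Suc j}.
         growth X B I \<le> d * (\<Prod>i\<in>I. growth A B (I - {i})) powr (1 / j)))"
    by blast
  define c' where "c' = max (c * d) (d * (c ^ Suc j) powr (1 / j))"
  have "\<exists>X\<subseteq>A. X \<noteq> {} \<and> real (card A) \<le> c' * real (card X) \<and>
      (\<forall>J. J \<subseteq> K \<longrightarrow> card J = Suc j \<longrightarrow> growth X B J \<le> c' * mean_growth A B l J)"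
    if adm: "admissible A B K" for A :: "'a set" and B
  proof -
    obtain X where X: "X \<subseteq> A" "X \<noteq> {}" "real (card A) \<le> c * real (card X)"
      "\<And>J. J \<subseteq> K \<Longrightarrow> card J = j \<Longrightarrow> growth X B J \<le> c * mean_growth A B l J"
      using cX[OF adm] by blast
    have "admissible X B K" using admissible_subset[OF adm X(1,2)] by auto
    from dX[OF this] obtain Y where Y: "Y \<subseteq> X" "Y \<noteq> {}" "real (card X) \<le> d * real (card Y)"
      and YI: "\<forall>I\<in>{I. I \<subseteq> K \<and> card I = Suc j}.
         growth Y B I \<le> d * (\<Prod>i\<in>I. growth X B (I - {i})) powr (1 / j)"
      by blast
    have "c * real (card X) \<le> c * (d * real (card Y))" using c Y(3) by (intro mult_left_mono) auto
    then have "real (card A) \<le> (c * d) * real (card Y)" using X(3) by simp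
    also have "\<dots> \<le> c' * real (card Y)" by (intro mult_right_mono) (auto simp: c'_def)
    finally have AY: "real (card A) \<le> c' * real (card Y)" .
    have "growth Y B J \<le> c' * mean_growth A B l J" if J: "J \<subseteq> K" "card J = Suc j" for J
    proof -
      have finJ: "finite J" using J K finite_subset by blast
      have "(\<Prod>i\<in>J. growth X B (J - {i})) \<le> (\<Prod>i\<in>J. c * mean_growth A B l (J - {i}))"
        using J finJ by (intro prod_mono conjI growth_nonneg X(4)) (auto simp: card_Diff_singleton)
      also have "\<dots> = c ^ Suc j * (\<Prod>i\<in>J. mean_growth A B l (J - {i}))"
        using J by (simp add: prod.distrib)
      finally have "(\<Prod>i\<in>J. growth X B (J - {i})) powr (1 / j)
          \<le> (c ^ Suc j * (\<Prod>i\<in>J. mean_growth A B l (J - {i}))) powr (1 / j)"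
        by (intro powr_mono2) (auto intro: prod_nonneg growth_nonneg)
      also have "\<dots> = (c ^ Suc j) powr (1 / j) * (\<Prod>i\<in>J. mean_growth A B l (J - {i})) powr (1 / j)"
        by (rule powr_mult)
      also have "\<dots> = (c ^ Suc j) powr (1 / j) * mean_growth A B l J"
        unfolding mean_growth_step[OF finJ J(2) l step(1)] ..
      finally have "d * (\<Prod>i\<in>J. growth X B (J - {i})) powr (1 / j)
          \<le> d * ((c ^ Suc j) powr (1 / j) * mean_growth A B l J)"
        using d by (intro mult_left_mono) auto
      also have "\<dots> \<le> c' * mean_growth A B l J"
        unfolding mult.assoc[symmetric]
        by (intro mult_right_mono) (auto simp: c'_def mean_growth_nonneg)
      finally show ?thesis using bspec[OF YI, of J] J by simp
    qed
    then show ?thesis using AY X(1) Y(1,2) by (intro exI[of _ Y]) auto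
  qed
  moreover have "1 \<le> c'" using c d mult_mono[of 1 c 1 d] by (simp add: c'_def)
  ultimately show ?case by blast
qed

section \<open>The tensor power trick\<close>

text \<open>Padding with \<open>0\<close> places all powers of \<open>A\<close> in the single group \<open>nat \<Rightarrow> 'a\<close>, so that one constant
  serves for all of them.\<close>

definition cart_power :: "nat \<Rightarrow> 'a::zero set \<Rightarrow> (nat \<Rightarrow> 'a) set" where
  "cart_power r A = {f. (\<forall>i<r. f i \<in> A) \<and> (\<forall>i\<ge>r. f i = 0)}"

lemma cart_power_0: "cart_power 0 A = {0}"
  by (auto simp: cart_power_def zero_fun_def)

lemma cart_power_Suc:
  "cart_power (Suc r) A = (\<lambda>(f, a). f(r := a)) ` (cart_power r A \<times> A)"
proof (intro equalityI subsetI)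
  fix f assume f: "f \<in> cart_power (Suc r) A"
  then have "f(r := 0) \<in> cart_power r A" "f r \<in> A" by (auto simp: cart_power_def)
  moreover have "f = (\<lambda>(f, a). f(r := a)) (f(r := 0), f r)" by auto
  ultimately show "f \<in> (\<lambda>(f, a). f(r := a)) ` (cart_power r A \<times> A)" by blast
qed (auto simp: cart_power_def less_Suc_eq)

lemma inj_on_cart_power_Suc: "inj_on (\<lambda>(f, a). f(r := a)) (cart_power r A \<times> A)"
proof (rule inj_onI, clarify)
  fix f a g b assume "f \<in> cart_power r A" "g \<in> cart_power r A" and eq: "f(r := a) = g(r := b)"
  then have "f r = g r" by (simp add: cart_power_def)
  then have "f = g" using eq by (metis fun_upd_triv fun_upd_upd)
  then show "f = g \<and> a = b" using fun_cong[OF eq, of r] by simp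
qed

lemma finite_cart_power: "finite A \<Longrightarrow> finite (cart_power r A)"
  by (induction r) (simp_all add: cart_power_0 cart_power_Suc)

lemma card_cart_power: "card (cart_power r A) = card A ^ r"
  by (induction r)
     (simp_all add: cart_power_0 cart_power_Suc card_image inj_on_cart_power_Suc card_cartesian_product)

lemma cart_power_nonempty: "A \<noteq> {} \<Longrightarrow> cart_power r A \<noteq> {}"
  by (induction r) (simp_all add: cart_power_0 cart_power_Suc)

lemma sumset_cart_power:
  "sumset (cart_power r X) (cart_power r Y) = cart_power r (sumset X Y)"
proof (intro equalityI subsetI)
  fix h assume h: "h \<in> cart_power r (sumset X Y)"
  have "\<exists>p. p \<in> X \<times> Y \<and> h i = fst p + snd p" if "i < r" for i
  proof -
    have "h i \<in> sumset X Y" using h that by (simp add: cart_power_def)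
    then show ?thesis unfolding sumset_def by force
  qed
  then have "\<forall>i\<in>{..<r}. \<exists>p. p \<in> X \<times> Y \<and> h i = fst p + snd p" by simp
  then obtain p where p: "\<forall>i\<in>{..<r}. p i \<in> X \<times> Y \<and> h i = fst (p i) + snd (p i)"
    by (rule bchoice[THEN exE])
  define f where "f = (\<lambda>i. if i < r then fst (p i) else 0)"
  define g where "g = (\<lambda>i. if i < r then snd (p i) else 0)"
  have "f \<in> cart_power r X" "g \<in> cart_power r Y"
    using p by (auto simp: f_def g_def cart_power_def mem_Times_iff)
  moreover have "h = f + g"
    using p h by (auto simp: f_def g_def cart_power_def plus_fun_def)
  ultimately show "h \<in> sumset (cart_power r X) (cart_power r Y)" unfolding sumset_def by blast
next
  fix h assume "h \<in> sumset (cart_power r X) (cart_power r Y)"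
  then obtain f g where "h = f + g" "f \<in> cart_power r X" "g \<in> cart_power r Y"
    unfolding sumset_def by blast
  then show "h \<in> cart_power r (sumset X Y)"
    by (simp add: cart_power_def sumsetI)
qed

lemma shifted_cart_power:
  assumes "finite I"
  shows "shifted (cart_power r A) (\<lambda>i. cart_power r (B i)) I = cart_power r (shifted A B I)"
  using assms by (induction I) (simp_all add: shifted_insert sumset_cart_power)

lemma growth_cart_power:
  "finite I \<Longrightarrow> growth (cart_power r A) (\<lambda>i. cart_power r (B i)) I = growth A B I ^ r"
  by (simp add: growth_def shifted_cart_power card_cart_power power_divide)

lemma mean_growth_cart_power:
  assumes "finite J"
  shows "mean_growth (cart_power r A) (\<lambda>i. cart_power r (B i)) l J = mean_growth A B l J ^ r"
proof -
  have "(\<Prod>L | L \<subseteq> J \<and> card L = l. growth (cart_power r A) (\<lambda>i. cart_power r (B i)) L) =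
      (\<Prod>L | L \<subseteq> J \<and> card L = l. growth A B L) ^ r"
    unfolding prod_power_distrib
    using assms by (intro prod.cong) (auto simp: growth_cart_power finite_subset[of _ J])
  moreover have "(x ^ r) powr e = (x powr e) ^ r" for x e :: real
    by (induction r) (simp_all add: powr_mult)
  ultimately show ?thesis by (simp add: mean_growth_def)
qed

lemma admissible_cart_power:
  "admissible A B K \<Longrightarrow> admissible (cart_power r A) (\<lambda>i. cart_power r (B i)) K"
  by (simp add: admissible_def finite_cart_power cart_power_nonempty)

section \<open>The magnification ratio of direct powers\<close>

text \<open>Cut Y into fibres on which all coordinates but j are fixed. A fibre is a copy of a
  subset X of A, and adding Z in coordinate j yields a copy of X + Z with the same other
  coordinates. The fibres therefore do not interfere and \<open>magn\<close> can be summed.\<close>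

lemma card_sumset_coordinate:
  fixes Y :: "(nat \<Rightarrow> 'a::ab_group_add) set" and M :: real
  assumes Y: "finite Y" "\<And>f. f \<in> Y \<Longrightarrow> f j \<in> A" and Z: "finite Z"
    and magn: "\<And>X. X \<subseteq> A \<Longrightarrow> M * real (card X) \<le> real (card (sumset X Z))"
  shows "M * real (card Y) \<le> real (card (sumset Y ((\<lambda>z. 0(j := z)) ` Z)))" (is "_ \<le> real (card ?S)")
proof -
  define h where "h = (\<lambda>f :: nat \<Rightarrow> 'a. f(j := 0))"
  define fib where "fib = (\<lambda>g. {f \<in> Y. h f = g})"
  have finS: "finite ?S" using Y(1) Z by (intro finite_sumset) auto
  have fibre: "M * real (card (fib g)) \<le> real (card {f \<in> ?S. h f = g})" if "g \<in> h ` Y" for g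
  proof -
    define X where "X = (\<lambda>f. f j) ` fib g"
    have rep: "f = g(j := f j)" if "f \<in> fib g" for f using that unfolding fib_def h_def by force
    have "inj_on (\<lambda>f. f j) (fib g)"
    proof (rule inj_onI)
      fix f f' assume "f \<in> fib g" "f' \<in> fib g" "f j = f' j"
      then show "f = f'" using rep[of f] rep[of f'] by simp
    qed
    then have "card (fib g) = card X" by (simp add: X_def card_image)
    moreover have "X \<subseteq> A" using Y(2) by (auto simp: X_def fib_def)
    then have "M * real (card X) \<le> real (card (sumset X Z))" by (rule magn)
    moreover have "card (sumset X Z) \<le> card {f \<in> ?S. h f = g}"
    proof (rule card_inj_on_le)
      show "inj_on (\<lambda>v. g(j := v)) (sumset X Z)" 
        by (rule inj_onI, drule fun_cong[of _ _ j]) simp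
      show "(\<lambda>v. g(j := v)) ` sumset X Z \<subseteq> {f \<in> ?S. h f = g}"
      proof (rule image_subsetI)
        fix v assume "v \<in> sumset X Z"
        then obtain f z where f: "f \<in> fib g" "z \<in> Z" "v = f j + z"
          by (auto simp: X_def elim!: sumsetE)
        have g: "h f = g" "f \<in> Y" using f by (auto simp: fib_def)
        have "g(j := v) = f + 0(j := z)"
        proof
          fix i show "(g(j := v)) i = (f + 0(j := z)) i"
            using g f by (auto simp: h_def)
        qed
        then have "g(j := v) \<in> ?S" using g f by (simp add: sumsetI)
        moreover have "h (g(j := v)) = g" using g by (auto simp: h_def)
        ultimately show "g(j := v) \<in> {f \<in> ?S. h f = g}" by simp
      qed
      show "finite {f \<in> ?S. h f = g}" using finS by simp
    qed
    ultimately show ?thesis by simp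
  qed
  have "M * real (card Y) = (\<Sum>g\<in>h ` Y. M * real (card (fib g)))"
  proof -
    have "(\<Sum>g\<in>h ` Y. card (fib g)) = card Y"
      using sum.group[of Y "h ` Y" h "\<lambda>_. 1::nat"] Y(1) by (simp add: fib_def)
    then show ?thesis by (simp flip: sum_distrib_left of_nat_sum)
  qed
  also have "\<dots> \<le> (\<Sum>g\<in>h ` Y. real (card {f \<in> ?S. h f = g}))"
    by (intro sum_mono fibre)
  also have "\<dots> = real (card (\<Union>g\<in>h ` Y. {f \<in> ?S. h f = g}))"
    using Y(1) finS by (subst card_UN_disjoint) auto
  also have "\<dots> \<le> real (card ?S)" using finS by (intro of_nat_mono card_mono) auto
  finally show ?thesis .
qed

text \<open>Adding the r-th power of Z means adding Z in one coordinate after the other, and each of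
  these steps gains a factor M.\<close>

lemma card_sumset_cart_power:
  fixes Y :: "(nat \<Rightarrow> 'a::ab_group_add) set" and M :: real
  assumes M: "0 \<le> M" and Z: "finite Z"
    and magn: "\<And>X. X \<subseteq> A \<Longrightarrow> M * real (card X) \<le> real (card (sumset X Z))"
    and Y: "finite Y" "\<And>f i. f \<in> Y \<Longrightarrow> i < r \<Longrightarrow> f i \<in> A"
  shows "M ^ r * real (card Y) \<le> real (card (sumset Y (cart_power r Z)))"
  using Y(2)
proof (induction r)
  case 0
  have "sumset Y {0} = Y" by (auto simp: sumset_def)
  then show ?case by (simp add: cart_power_0)
next
  case (Suc r)
  define Y' where "Y' = sumset Y (cart_power r Z)"
  have "cart_power (Suc r) Z = sumset (cart_power r Z) ((\<lambda>z. 0(r := z)) ` Z)"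
  proof -
    have "f(r := z) = f + 0(r := z)" if "f \<in> cart_power r Z" for f z
      using that by (auto simp: cart_power_def)
    then have "(\<lambda>(f, a). f(r := a)) ` (cart_power r Z \<times> Z) =
        (\<lambda>(f, a). f + 0(r := a)) ` (cart_power r Z \<times> Z)"
      by (intro image_cong) auto
    also have "\<dots> = sumset (cart_power r Z) ((\<lambda>z. 0(r := z)) ` Z)"
    proof (intro equalityI subsetI)
      fix v assume "v \<in> sumset (cart_power r Z) ((\<lambda>z. 0(r := z)) ` Z)"
      then obtain f z where "f \<in> cart_power r Z" "z \<in> Z" "v = f + 0(r := z)"
        by (auto elim!: sumsetE)
      then show "v \<in> (\<lambda>(f, a). f + 0(r := a)) ` (cart_power r Z \<times> Z)"
        by (intro image_eqI[of _ _ "(f, z)"]) auto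
    qed (auto intro: sumsetI)
    finally show ?thesis unfolding cart_power_Suc .
  qed
  then have eq: "sumset Y (cart_power (Suc r) Z) = sumset Y' ((\<lambda>z. 0(r := z)) ` Z)"
    by (simp add: Y'_def sumset_assoc)
  have "M ^ Suc r * real (card Y) = M * (M ^ r * real (card Y))" by simp
  also have "\<dots> \<le> M * real (card Y')"
    unfolding Y'_def using Suc M by (intro mult_left_mono) auto
  also have "\<dots> \<le> real (card (sumset Y' ((\<lambda>z. 0(r := z)) ` Z)))"
  proof (rule card_sumset_coordinate[OF _ _ Z magn])
    show "finite Y'" unfolding Y'_def by (intro finite_sumset finite_cart_power Y(1) Z)
    \<comment> \<open>Earlier steps changed only coordinates below r, so coordinate r is still that
      of an element of Y.\<close>
    fix f assume "f \<in> Y'"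
    then obtain g k where "g \<in> Y" "k \<in> cart_power r Z" "f = g + k"
      unfolding Y'_def sumset_def by blast
    then show "f r \<in> A" using Suc.prems by (simp add: cart_power_def)
  qed
  finally show ?case unfolding eq .
qed

text \<open>Tensor power trick: the magnification ratio is multiplicative under direct powers,
  so the constant in the previous bound disappears in the limit.\<close>

theorem pluennecke_different_summands:
  fixes A :: "'a::ab_group_add set" and l :: nat
  assumes K: "finite K" and l: "0 < l" "l \<le> card K" and adm: "admissible A B K"
  shows "\<exists>X\<subseteq>A. X \<noteq> {} \<and> growth X B K \<le> mean_growth A B l K"
proof -
  define \<beta> where "\<beta> = mean_growth A B l K"
  have fin: "finite A" "A \<noteq> {}" using adm by (auto simp: admissible_def)
  have "finite {X. X \<subseteq> A \<and> X \<noteq> {}}" "{X. X \<subseteq> A \<and> X \<noteq> {}} \<noteq> {}" using fin by auto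
  \<comment> \<open>X attains the magnification ratio, which unlike the ratio of an arbitrary subset
    also bounds the growth in direct powers from below.\<close>
  then obtain X where "is_arg_min (\<lambda>X. growth X B K) (\<lambda>X. X \<in> {X. X \<subseteq> A \<and> X \<noteq> {}}) X"
    using ex_is_arg_min_if_finite by blast
  then have X: "X \<subseteq> A" "X \<noteq> {}"
    and Xmin: "\<And>X'. X' \<subseteq> A \<Longrightarrow> X' \<noteq> {} \<Longrightarrow> growth X B K \<le> growth X' B K"
    unfolding is_arg_min_linorder by auto
  define \<mu> where "\<mu> = growth X B K"
  have "\<mu> \<le> \<beta>"
  proof (rule ccontr)
    assume "\<not> \<mu> \<le> \<beta>"
    have "0 < \<beta>" unfolding \<beta>_def mean_growth_def
    proof -
      have "0 < (\<Prod>L | L \<subseteq> K \<and> card L = l. growth A B L)"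
        using growth_pos[OF K adm] by (intro prod_pos) auto
      then show "0 < (\<Prod>L | L \<subseteq> K \<and> card L = l. growth A B L) powr
          (1 / real ((card K - 1) choose (l - 1)))" by simp
    qed
    then have q: "1 < \<mu> / \<beta>" using \<open>\<not> \<mu> \<le> \<beta>\<close> by simp
    \<comment> \<open>This constant is fixed for the whole type \<open>nat \<Rightarrow> 'a\<close>
      before the exponent r is chosen to beat it.\<close>
    obtain c where c: "\<And>(A::(nat \<Rightarrow> 'a) set) B. admissible A B K \<Longrightarrow>
      \<exists>X\<subseteq>A. X \<noteq> {} \<and> growth X B K \<le> c * mean_growth A B l K"
    proof -
      obtain c where c: "\<forall>(A::(nat \<Rightarrow> 'a) set) B. admissible A B K \<longrightarrow>
          (\<exists>X\<subseteq>A. X \<noteq> {} \<and> real (card A) \<le> c * real (card X) \<and>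
            (\<forall>J. J \<subseteq> K \<longrightarrow> card J = card K \<longrightarrow> growth X B J \<le> c * mean_growth A B l J))"
        using pluennecke_up_to_constant[OF K l, where 'a = "nat \<Rightarrow> 'a"] by (elim exE conjE)
      then have "\<exists>X\<subseteq>A. X \<noteq> {} \<and> growth X B K \<le> c * mean_growth A B l K"
        if "admissible A B K" for A :: "(nat \<Rightarrow> 'a) set" and B
        using c[rule_format, OF that] by blast
      then show thesis by (rule that)
    qed
    obtain r where r: "c < (\<mu> / \<beta>) ^ r" using real_arch_pow[OF q] by blast
    let ?A = "cart_power r A" and ?B = "\<lambda>i. cart_power r (B i)"
    obtain Y where Y: "Y \<subseteq> ?A" "Y \<noteq> {}" and "growth Y ?B K \<le> c * mean_growth ?A ?B l K"
      using c[OF admissible_cart_power[OF adm, of r]] by blast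
    then have le: "growth Y ?B K \<le> c * \<beta> ^ r"
      by (simp add: mean_growth_cart_power[OF K] \<beta>_def)
    have finY: "finite Y" using Y(1) finite_cart_power[OF fin(1)] by (rule finite_subset)
    have "\<mu> ^ r * real (card Y) \<le> real (card (sumset Y (cart_power r (sumset_fam B K))))"
    proof (rule card_sumset_cart_power)
      show "0 \<le> \<mu>" by (simp add: \<mu>_def growth_nonneg)
      have "finite (shifted {0} B K)"
        using K adm by (intro finite_shifted) (auto simp: admissible_def)
      then show "finite (sumset_fam B K)" by (simp add: sumset_zero)
      fix X' assume X': "X' \<subseteq> A"
      show "\<mu> * real (card X') \<le> real (card (shifted X' B K))"
      proof (cases "X' = {}")
        case False
        then show ?thesis
          using card_shifted_eq_growth[of X' B K] X' fin Xmin[OF X' False] finite_subset[OF X']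
          by (simp add: \<mu>_def mult_right_mono)
      qed simp
    qed (use Y finY in \<open>auto simp: cart_power_def\<close>)
    \<comment> \<open>Reduced to \<open>shifted_cart_power\<close> by writing a family sumset as one
      shifted by {0}; every power of {0} is again {0}.\<close>
    also have "cart_power r (sumset_fam B K) = sumset_fam ?B K"
    proof -
      have "shifted {0} ?B K = cart_power r (shifted {0} B K)"
      proof -
        have "cart_power r {0::'a} = {0}"
        proof (intro equalityI subsetI)
          fix f assume f: "f \<in> cart_power r {0::'a}"
          have "f i = 0" for i using f by (cases "i < r") (auto simp: cart_power_def)
          then show "f \<in> {0}" by auto
        qed (simp add: cart_power_def)
        then show ?thesis using shifted_cart_power[OF K, of r "{0}" B] by simp
      qed
      then show ?thesis by (simp add: sumset_zero)
    qed
    also have "real (card (shifted Y ?B K)) = growth Y ?B K * real (card Y)"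
      by (rule card_shifted_eq_growth[OF finY Y(2)])
    finally have "\<mu> ^ r \<le> growth Y ?B K"
      using finY Y(2) by (simp add: card_gt_0_iff)
    with le have "(\<mu> / \<beta>) ^ r \<le> c" using \<open>0 < \<beta>\<close> by (simp add: power_divide divide_le_eq)
    with r show False by simp
  qed
  then show ?thesis using X by (auto simp: \<mu>_def \<beta>_def)
qed

section \<open>Large subsets\<close>

text \<open>Each of the (k choose l) growth factors increases at most by q = |A| / |X|. The exponent
  k/l results from l (k choose l) = k ((k-1) choose (l-1)).\<close>

lemma mean_growth_subset:
  assumes K: "finite K" and l: "0 < l" "l \<le> card K" and adm: "admissible A B K"
    and X: "X \<subseteq> A" "X \<noteq> {}"
  shows "mean_growth X B l K \<le>
    mean_growth A B l K * (real (card A) / real (card X)) powr (real (card K) / real l)"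
proof -
  define q where "q = real (card A) / real (card X)"
  define N where "N = card K choose l"
  define M where "M = (card K - 1) choose (l - 1)"
  have cX: "0 < card X" using X adm by (auto simp: admissible_def card_gt_0_iff finite_subset[of X A])
  have cA: "0 < card A" using X adm by (auto simp: admissible_def card_gt_0_iff)
  have q: "0 < q" "real (card A) \<le> q * real (card X)" using cX cA by (simp_all add: q_def)
  have N: "N > 0" "M > 0" using l by (auto simp: N_def M_def intro!: zero_less_binomial)
  have "l * N = card K * M"
    using binomial_absorption[of "l - 1" "card K"] l by (simp add: N_def M_def)
  then have "real l * real N = real (card K) * real M" by (metis of_nat_mult)
  then have exponent: "real N * (1 / real M) = real (card K) / real l"
    using N l by (simp add: field_simps)
  have "(\<Prod>L | L \<subseteq> K \<and> card L = l. growth X B L) \<le> (\<Prod>L | L \<subseteq> K \<and> card L = l. q * growth A B L)"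
    using X K adm q by (intro prod_mono conjI growth_nonneg growth_subset[of K]) auto
  also have "\<dots> = q ^ N * (\<Prod>L | L \<subseteq> K \<and> card L = l. growth A B L)"
    using K by (simp add: prod.distrib n_subsets N_def)
  finally have "mean_growth X B l K \<le>
      (q ^ N * (\<Prod>L | L \<subseteq> K \<and> card L = l. growth A B L)) powr (1 / real M)"
    unfolding mean_growth_def M_def by (intro powr_mono2) (auto intro!: prod_nonneg growth_nonneg)
  also have "\<dots> = (q ^ N) powr (1 / real M) * mean_growth A B l K"
    unfolding mean_growth_def M_def by (rule powr_mult)
  also have "(q ^ N) powr (1 / real M) = q powr (real (card K) / real l)"
    using q(1) by (simp add: powr_powr exponent[simplified] flip: powr_realpow)
  finally show ?thesis by (simp add: q_def mult.commute)
qed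

text \<open>A left endpoint rectangle lies below the integral of an increasing function: the right
  side is the integral of (m - x) powr (- p) from r to s, evaluated through its primitive.\<close>

lemma powr_tangent:
  fixes m r s p :: real
  assumes "1 < p" "r \<le> s" "s < m"
  shows "(s - r) * (m - r) powr (- p) \<le> ((m - s) powr (1 - p) - (m - r) powr (1 - p)) / (p - 1)"
proof (cases "r = s")
  case False
  then have "r < s" using assms by simp
  define F where "F = (\<lambda>x. (m - x) powr (1 - p) / (p - 1))"
  have "\<exists>z. r < z \<and> z < s \<and> F s - F r = (s - r) * (m - z) powr (- p)"
  proof (rule MVT2[OF \<open>r < s\<close>])
    fix x assume "r \<le> x" "x \<le> s"
    then have "0 < m - x" using assms by simp
    moreover have "((\<lambda>x. m - x) has_real_derivative - 1) (at x)"
      by (auto intro!: derivative_eq_intros)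
    ultimately have "(F has_real_derivative ((1 - p) * (m - x) powr (1 - p - 1) * (- 1)) / (p - 1)) (at x)"
      unfolding F_def using DERIV_cdivide[OF DERIV_fun_powr[of "\<lambda>x. m - x" "- 1" x "1 - p"]] by simp
    moreover have "((1 - p) * (m - x) powr (1 - p - 1) * (- 1)) / (p - 1) = (m - x) powr (- p)"
      using assms by (simp add: field_simps)
    ultimately show "(F has_real_derivative (m - x) powr (- p)) (at x)" by simp
  qed
  then obtain z where z: "r < z" "z < s" "F s - F r = (s - r) * (m - z) powr (- p)" by blast
  have "(m - r) powr (- p) \<le> (m - z) powr (- p)"
    using z assms by (intro powr_mono2') auto
  then have "(s - r) * (m - r) powr (- p) \<le> F s - F r"
    unfolding z(3) using assms by (intro mult_left_mono) auto
  then show ?thesis by (simp add: F_def diff_divide_distrib)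
qed simp

theorem theorem9:
  fixes A :: "'a::ab_group_add set" and B :: "nat \<Rightarrow> 'a set" and k l :: nat
  assumes "0 < l" and "l < k"
    and "finite A" and "A \<noteq> {}"
    and "\<And>i. i \<in> {1..k} \<Longrightarrow> finite (B i)"
  defines "m \<equiv> card A"
    and "\<beta> \<equiv> (\<Prod>L\<in>{L. L \<subseteq> {1..k} \<and> card L = l}.
                 real (card (sumset A (sumset_fam B L))) / real (card A))
               powr (real (fact (l - 1) * fact (k - l)) / real (fact (k - 1)))"
  shows
    "(\<forall>a::nat. 1 \<le> a \<and> a \<le> m \<longrightarrow>
       (\<exists>X\<subseteq>A. card X \<ge> a \<and>
          real (card (sumset X (sumset_fam B {1..k})))
            \<le> \<beta> * real m powr (real k / real l) *
               ((\<Sum>j<a. real (m - j) powr (- (real k / real l)))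
                + (real (card X) - real a) * real (m - a + 1) powr (- (real k / real l)))))
     \<and>
     (\<forall>t::real. 0 \<le> t \<and> t < real m \<longrightarrow>
       (\<exists>X\<subseteq>A. real (card X) > t \<and>
          real (card (sumset X (sumset_fam B {1..k})))
            \<le> \<beta> * real m powr (real k / real l) *
               (real l / real (k - l) *
                  ((real m - t) powr (1 - real k / real l) - real m powr (1 - real k / real l))
                + (real (card X) - t) * (real m - t) powr (- (real k / real l)))))"
proof (cases "\<exists>i\<in>{1..k}. B i = {}")
  case True
  then obtain i where i: "i \<in> {1..k}" "B i = {}" by blast
  \<comment> \<open>With an empty summand the sumset to be bounded is empty, so X = A works once the
    right sides are seen to be nonnegative.\<close>
  have "sumset_fam B {1..k} = {}"
    using shifted_eq_empty[of i "{1..k}" B "{0}"] i by (simp add: sumset_zero)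
  then have zero: "card (sumset A (sumset_fam B {1..k})) = 0" by (simp add: sumset_def)
  have p: "1 - real k / real l \<le> 0" using assms(1,2) by (simp add: field_simps)
  have "0 \<le> \<beta>" by (simp add: \<beta>_def)
  have a: "real (card (sumset A (sumset_fam B {1..k}))) \<le> \<beta> * real m powr (real k / real l) *
               ((\<Sum>j<a. real (m - j) powr (- (real k / real l)))
                + (real (card A) - real a) * real (m - a + 1) powr (- (real k / real l)))"
    if "a \<le> m" for a
    unfolding zero using that \<open>0 \<le> \<beta>\<close>
    by (auto intro!: mult_nonneg_nonneg add_nonneg_nonneg sum_nonneg simp: m_def)
  have b: "real (card (sumset A (sumset_fam B {1..k}))) \<le> \<beta> * real m powr (real k / real l) *
               (real l / real (k - l) *
                  ((real m - t) powr (1 - real k / real l) - real m powr (1 - real k / real l))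
                + (real (card A) - t) * (real m - t) powr (- (real k / real l)))"
    if "0 \<le> t" "t < real m" for t
  proof -
    have "real m powr (1 - real k / real l) \<le> (real m - t) powr (1 - real k / real l)"
      using that p by (intro powr_mono2') auto
    then show ?thesis unfolding zero using that \<open>0 \<le> \<beta>\<close>
      by (auto intro!: mult_nonneg_nonneg add_nonneg_nonneg simp: m_def)
  qed
  show ?thesis using a b by (intro conjI allI impI exI[of _ A]) (auto simp: m_def)
next
  case False
  define K where "K = {1..k}"
  define p where "p = real k / real l"
  \<comment> \<open>By \<open>mean_growth_subset\<close>, f s bounds the mean growth of what is left
    of A after s elements have been removed.\<close>
  define f where "f = (\<lambda>s. \<beta> * real m powr p * (real m - s) powr (- p))"
  have K: "finite K" "card K = k" by (simp_all add: K_def)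
  have l: "0 < l" "l \<le> card K" using assms(1,2) K by auto
  have p: "1 < p" using assms(1,2) by (simp add: p_def)
  have adm: "admissible A B K" using assms(3-5) False by (auto simp: admissible_def K_def)
  have m: "0 < m" using assms(3,4) by (simp add: m_def card_gt_0_iff)
  have \<beta>: "\<beta> = mean_growth A B l K"
  proof -
    have "real (fact (l - 1) * fact (k - l)) / real (fact (k - 1)) = 1 / real ((k - 1) choose (l - 1))"
      using assms(1,2) by (simp add: binomial_fact)
    then show ?thesis by (simp add: \<beta>_def mean_growth_def growth_def K_def)
  qed
  have \<beta>0: "0 \<le> \<beta> * real m powr p" by (simp add: \<beta> mean_growth_nonneg)
  have f_mono: "f r \<le> f s" if "r \<le> s" "s < real m" for r s
    unfolding f_def using that p \<beta>0 by (intro mult_left_mono powr_mono2') auto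
  have step: "\<exists>X\<subseteq>A'. X \<noteq> {} \<and> real (card (shifted X B K)) \<le>
      f (real (card A) - real (card A')) * real (card X)"
    if "A' \<subseteq> A" "real (card A) - real (card A') \<le> t" "t < real m" for A' t
  proof -
    have c: "0 < card A'" using that by (auto simp: m_def)
    then have "A' \<noteq> {}" by auto
    then have adm': "admissible A' B K" using admissible_subset[OF adm that(1)] by auto
    obtain X where X: "X \<subseteq> A'" "X \<noteq> {}" "growth X B K \<le> mean_growth A' B l K"
      using pluennecke_different_summands[OF K(1) l adm'] by blast
    note X(3)
    also have "mean_growth A' B l K \<le> \<beta> * (real m / real (card A')) powr p"
      using mean_growth_subset[OF K(1) l adm that(1) \<open>A' \<noteq> {}\<close>] by (simp add: \<beta> m_def p_def K)
    also have "\<dots> = f (real (card A) - real (card A'))"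
      using c m by (simp add: f_def m_def powr_divide powr_minus_divide)
    finally have "growth X B K \<le> f (real (card A) - real (card A'))" .
    moreover have "finite X" using X(1) that(1) assms(3) by (meson finite_subset)
    ultimately have "real (card (shifted X B K)) \<le> f (real (card A) - real (card A')) * real (card X)"
      using card_shifted_eq_growth[of X B K] X(2) by (simp add: mult_right_mono)
    then show ?thesis using X by blast
  qed
  have a: "\<exists>X\<subseteq>A. a \<le> card X \<and> real (card (shifted X B K)) \<le> \<beta> * real m powr p *
      ((\<Sum>j<a. real (m - j) powr (- p)) + (real (card X) - real a) * real (m - a + 1) powr (- p))"
    if a: "1 \<le> a" "a \<le> m" for a
  proof -
    define G where "G = (\<lambda>s::real. \<Sum>j<nat \<lfloor>s\<rfloor>. f (real j))"
    \<comment> \<open>With this threshold, more than t elements means at least a. The first of the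
      |X| - t excess units, charged at rate f(a-1), becomes the last term of the sum in the
      claim.\<close>
    define t where "t = real (a - 1)"
    have t: "0 \<le> t" "t < real (card A)" using a by (simp_all add: t_def m_def)
    have "\<exists>X\<subseteq>A. t < real (card X) \<and> real (card (shifted X B K)) \<le> G t + (real (card X) - t) * f t"
    proof (rule greedy_union[OF assms(3) t])
      fix A' assume "A' \<subseteq> A" "real (card A) - real (card A') \<le> t"
      then show "\<exists>X\<subseteq>A'. X \<noteq> {} \<and> real (card (shifted X B K)) \<le>
          f (real (card A) - real (card A')) * real (card X)"
        using step t by (simp add: m_def)
    next
      show "0 \<le> G 0" by (simp add: G_def)
    next
      fix r :: nat and s :: real
      assume rs: "real r \<le> s" "s \<le> t" "s \<in> \<nat> \<or> s = t"
      then obtain n where n: "s = real n" by (auto simp: t_def elim: Nats_cases)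
      have "r \<le> n" using rs n by simp
      have "(s - real r) * f (real r) = (\<Sum>j\<in>{r..<n}. f (real r))"
        using \<open>r \<le> n\<close> by (simp add: n of_nat_diff)
      also have "\<dots> \<le> (\<Sum>j\<in>{r..<n}. f (real j))"
        using rs t n by (intro sum_mono f_mono) (auto simp: m_def)
      finally show "G (real r) + (s - real r) * f (real r) \<le> G s"
        using sum.atLeastLessThan_concat[of 0 r n "\<lambda>j. f (real j)"] \<open>r \<le> n\<close>
        by (simp add: G_def n lessThan_atLeast0)
    next
      fix r :: nat assume "real r \<le> t"
      then show "f (real r) \<le> f t" using t by (intro f_mono) (auto simp: m_def)
    qed
    then obtain X where X: "X \<subseteq> A" "t < real (card X)"
      "real (card (shifted X B K)) \<le> G t + (real (card X) - t) * f t" by blast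
    have "a \<le> card X" using X(2) a by (simp add: t_def)
    have ft: "f t = \<beta> * real m powr p * real (m - a + 1) powr (- p)"
      using a by (simp add: f_def t_def of_nat_diff algebra_simps)
    have t1: "t = real a - 1" using a by (simp add: t_def of_nat_diff)
    have "G t = (\<Sum>j<a - 1. f (real j))" unfolding G_def t_def floor_of_nat nat_int ..
    then have "G t + f t = (\<Sum>j<a. f (real j))"
      using a sum.lessThan_Suc[of "\<lambda>j. f (real j)" "a - 1"] by (simp add: t_def)
    also have "\<dots> = (\<Sum>j<a. \<beta> * real m powr p * real (m - j) powr (- p))"
      using a by (intro sum.cong) (auto simp: f_def of_nat_diff)
    finally have "G t + f t = \<beta> * real m powr p * (\<Sum>j<a. real (m - j) powr (- p))"
      by (simp add: sum_distrib_left)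
    moreover have "G t + (real (card X) - t) * f t = G t + f t + (real (card X) - real a) * f t"
      unfolding t1 by (simp add: algebra_simps)
    ultimately have "G t + (real (card X) - t) * f t = \<beta> * real m powr p *
      ((\<Sum>j<a. real (m - j) powr (- p)) + (real (card X) - real a) * real (m - a + 1) powr (- p))"
      unfolding ft by (simp add: algebra_simps)
    then show ?thesis using X \<open>a \<le> card X\<close> by auto
  qed
  have b: "\<exists>X\<subseteq>A. t < real (card X) \<and> real (card (shifted X B K)) \<le> \<beta> * real m powr p *
      (real l / real (k - l) * ((real m - t) powr (1 - p) - real m powr (1 - p)) +
        (real (card X) - t) * (real m - t) powr (- p))"
    if t: "0 \<le> t" "t < real m" for t
  proof -
    \<comment> \<open>The primitive of f that vanishes at 0; its factor 1 / (p - 1) equals l / (k -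
      l).\<close>
    define G where "G = (\<lambda>s. \<beta> * real m powr p *
      (((real m - s) powr (1 - p) - real m powr (1 - p)) / (p - 1)))"
    have "\<exists>X\<subseteq>A. t < real (card X) \<and> real (card (shifted X B K)) \<le> G t + (real (card X) - t) * f t"
    proof (rule greedy_union)
      show "t < real (card A)" using t by (simp add: m_def)
    next
      fix A' assume "A' \<subseteq> A" "real (card A) - real (card A') \<le> t"
      then show "\<exists>X\<subseteq>A'. X \<noteq> {} \<and> real (card (shifted X B K)) \<le>
          f (real (card A) - real (card A')) * real (card X)"
        using step t by simp
    next
      fix r :: nat and s :: real
      assume rs: "real r \<le> s" "s \<le> t"
      have "\<beta> * real m powr p * ((s - real r) * (real m - real r) powr (- p)) \<le> \<beta> * real m powr p *
          (((real m - s) powr (1 - p) - (real m - real r) powr (1 - p)) / (p - 1))"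
        using rs t p \<beta>0 by (intro mult_left_mono powr_tangent) auto
      then show "G (real r) + (s - real r) * f (real r) \<le> G s"
        by (simp add: G_def f_def diff_divide_distrib algebra_simps)
    next
      fix r :: nat assume "real r \<le> t"
      then show "f (real r) \<le> f t" using t by (intro f_mono) auto
    qed (use t assms(3) in \<open>simp_all add: G_def\<close>)
    then obtain X where X: "X \<subseteq> A" "t < real (card X)"
      "real (card (shifted X B K)) \<le> G t + (real (card X) - t) * f t" by blast
    have "real l / real (k - l) = 1 / (p - 1)"
      using assms(1,2) by (simp add: p_def of_nat_diff field_simps)
    then have "G t + (real (card X) - t) * f t = \<beta> * real m powr p *
      (real l / real (k - l) * ((real m - t) powr (1 - p) - real m powr (1 - p)) +
        (real (card X) - t) * (real m - t) powr (- p))"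
      by (simp add: G_def f_def distrib_left mult.left_commute)
    then show ?thesis using X by auto
  qed
  show ?thesis using a b unfolding K_def p_def by blast
qed

end
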